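(* Let $n\ge5$ and fix $\sigma_0\in(1,2)$ and $\theta\in(0,\bar\theta)$. Then there exists a concave, increasing function $f:[0,\infty)\to[0,\infty)$ such that $f(s)=\frac{s}{n-2\sigma_0}$ for all sufficiently small $s\ge 0$, $\lim_{s\to\infty}\frac{f(s)}{s}=\frac{1}{n-2}$, and the set $$\{R=S+H\odot\mathrm{id}:\ S\in PIC2,\ \mathrm{Ric}_0(S)=0,\ f(\mathrm{tr}(H))\,\mathrm{id}-H\ge0,\ \mathrm{tr}(H)-\theta\,\mathrm{scal}(S)\ge0\}$$ is invariant under the Hamilton ODE.
   Context: An algebraic curvature tensor on $\mathbb{R}^n$ is a tensor $R=(R_{ijkl})$ with $R_{ijkl}=-R_{jikl}=R_{klij}$ and $R_{ijkl}+R_{jkil}+R_{kijl}=0$; the unit round sphere has $R_{ijkl}=\delta_{ik}\delta_{jl}-\delta_{il}\delta_{jk}$. We write $\mathrm{Ric}(R)_{ik}=\sum_j R_{ijkj}$, $\mathrm{scal}(R)=\sum_i\mathrm{Ric}(R)_{ii}$, $\mathrm{Ric}_0(R)=\mathrm{Ric}(R)-\frac1n\mathrm{scal}(R)\,\mathrm{id}$. For symmetric bilinear forms $A,B$, $(A\odot B)_{ijkl}=A_{ik}B_{jl}-A_{il}B_{jk}-A_{jk}B_{il}+A_{jl}B_{ik}$; $\mathrm{id}=(\delta_{ij})$. The PIC2 cone is the set of algebraic curvature tensors $R$ with $R(z,w,\bar z,\bar w)\ge0$ for all $z,w\in\mathbb{C}^n$ ($R$ extended complex-multilinearly). In the set,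 $S$ ranges over algebraic curvature tensors, $H$ over symmetric bilinear forms, and "$\ge0$" means positive semidefinite. For algebraic curvature tensors $S,T$ let $B(S,T)_{ijkl}=\frac12\sum_{p,q}(S_{ijpq}T_{klpq}+S_{klpq}T_{ijpq})+\sum_{p,q}(S_{ipkq}T_{jplq}-S_{iplq}T_{jpkq}-S_{jpkq}T_{iplq}+S_{jplq}T_{ipkq})$ and $Q(R)=B(R,R)$. The Hamilton ODE is $\frac{d}{dt}R=Q(R)$; a set $F$ is invariant under it if every solution with $R(0)\in F$ satisfies $R(t)\in F$ for all $t\ge0$ in its interval of existence. For $\sigma\in(0,2]$, $\theta\ge0$, $\mathcal{C}_{\sigma,\theta}$ is the set of $R=S+H\odot\mathrm{id}$ with $S\in PIC2$, $\mathrm{Ric}_0(S)=0$, $\mathrm{tr}(H)\,\mathrm{id}-(n-2\sigma)H\ge0$, $\mathrm{tr}(H)-\theta\,\mathrm{scal}(S)\ge0$. $\bar\theta=\bar\theta(n)>0$ denotes a constant such that for all $\sigma\in(0,2]$, $\theta\in[0,\bar\theta]$ the cone $\mathcal C_{\sigma,\theta}$ is invariant under the Hamilton ODE, and for $\sigma\in(0,1)\cup(1,2)$, $\theta\in(0,\bar\theta)$ it is transversally invariant away from $0$, i.e. for every $R\in\partial\mathcal C_{\sigma,\theta}\setminus\{0\}$, $Q(R)$ lies in the interior of the tangent cone of $\mathcal C_{\sigma,\theta}$ at $R$ (such a constant exists). *)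

theory Defs
  imports "HOL-Analysis.Analysis"
begin

text \<open>Tensors on R^n, with the index set {1..n} represented by a finite type 'n (n = CARD('n)).
  4-tensors are functions 'n => 'n => 'n => 'n => real, bilinear forms 'n => 'n => real.\<close>

type_synonym 'n tensor4 = "'n \<Rightarrow> 'n \<Rightarrow> 'n \<Rightarrow> 'n \<Rightarrow> real"
type_synonym 'n form2 = "'n \<Rightarrow> 'n \<Rightarrow> real"

definition alg_curv :: "('n::finite) tensor4 \<Rightarrow> bool" where
  "alg_curv R \<longleftrightarrow> (\<forall>i j k l. R i j k l = - R j i k l \<and> R i j k l = R k l i j \<and>
      R i j k l + R j k i l + R k i j l = 0)"

definition sym_form :: "('n::finite) form2 \<Rightarrow> bool" where
  "sym_form H \<longleftrightarrow> (\<forall>i j. H i j = H j i)"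

definition idf :: "('n::finite) form2" where
  "idf i j = (if i = j then 1 else 0)"

definition ric :: "('n::finite) tensor4 \<Rightarrow> 'n form2" where
  "ric R i k = (\<Sum>j\<in>UNIV. R i j k j)"

definition scal :: "('n::finite) tensor4 \<Rightarrow> real" where
  "scal R = (\<Sum>i\<in>UNIV. ric R i i)"

definition ric0 :: "('n::finite) tensor4 \<Rightarrow> 'n form2" where
  "ric0 R i k = ric R i k - scal R / real CARD('n) * idf i k"

definition trf :: "('n::finite) form2 \<Rightarrow> real" where
  "trf H = (\<Sum>i\<in>UNIV. H i i)"

definition kn :: "('n::finite) form2 \<Rightarrow> 'n form2 \<Rightarrow> 'n tensor4" where
  "kn A B i j k l = A i k * B j l - A i l * B j k - A j k * B i l + A j l * B i k"

definition psd :: "('n::finite) form2 \<Rightarrow> bool" where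
  "psd H \<longleftrightarrow> (\<forall>v::'n \<Rightarrow> real. 0 \<le> (\<Sum>i\<in>UNIV. \<Sum>j\<in>UNIV. H i j * v i * v j))"

definition cval :: "('n::finite) tensor4 \<Rightarrow> ('n \<Rightarrow> complex) \<Rightarrow> ('n \<Rightarrow> complex) \<Rightarrow> complex" where
  "cval R z w = (\<Sum>i\<in>UNIV. \<Sum>j\<in>UNIV. \<Sum>k\<in>UNIV. \<Sum>l\<in>UNIV.
      complex_of_real (R i j k l) * z i * w j * cnj (z k) * cnj (w l))"

definition PIC2 :: "('n::finite) tensor4 set" where
  "PIC2 = {R. alg_curv R \<and> (\<forall>z w. Im (cval R z w) = 0 \<and> 0 \<le> Re (cval R z w))}"

definition Bop :: "('n::finite) tensor4 \<Rightarrow> 'n tensor4 \<Rightarrow> 'n tensor4" where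
  "Bop S T i j k l =
     (1/2) * (\<Sum>p\<in>UNIV. \<Sum>q\<in>UNIV. S i j p q * T k l p q + S k l p q * T i j p q)
     + (\<Sum>p\<in>UNIV. \<Sum>q\<in>UNIV. S i p k q * T j p l q - S i p l q * T j p k q
                            - S j p k q * T i p l q + S j p l q * T i p k q)"

definition Qop :: "('n::finite) tensor4 \<Rightarrow> 'n tensor4" where
  "Qop R = Bop R R"

definition hamilton_solution :: "real \<Rightarrow> (real \<Rightarrow> ('n::finite) tensor4) \<Rightarrow> bool" where
  "hamilton_solution T R \<longleftrightarrow> 0 \<le> T \<and> (\<forall>t\<in>{0..T}. \<forall>i j k l.
      ((\<lambda>s. R s i j k l) has_real_derivative Qop (R t) i j k l) (at t within {0..T}))"

text \<open>Invariance: every solution starting in F stays in F on its interval of existence.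
  (Any solution on [0,T*) restricts to solutions on [0,T], T < T*.)\<close>
definition ode_invariant :: "('n::finite) tensor4 set \<Rightarrow> bool" where
  "ode_invariant F \<longleftrightarrow> (\<forall>T R. hamilton_solution T R \<longrightarrow> R 0 \<in> F \<longrightarrow> (\<forall>t\<in>{0..T}. R t \<in> F))"

definition tdist :: "('n::finite) tensor4 \<Rightarrow> 'n tensor4 \<Rightarrow> real" where
  "tdist A B = sqrt (\<Sum>i\<in>UNIV. \<Sum>j\<in>UNIV. \<Sum>k\<in>UNIV. \<Sum>l\<in>UNIV. (A i j k l - B i j k l)^2)"

definition cone_C :: "real \<Rightarrow> real \<Rightarrow> ('n::finite) tensor4 set" where
  "cone_C \<sigma> \<theta> = {R. \<exists>S H. S \<in> PIC2 \<and> sym_form H \<and> ric0 S = (\<lambda>i k. 0) \<and>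
      R = (\<lambda>i j k l. S i j k l + kn H idf i j k l) \<and>
      psd (\<lambda>i j. trf H * idf i j - (real CARD('n) - 2 * \<sigma>) * H i j) \<and>
      0 \<le> trf H - \<theta> * scal S}"

text \<open>Topological notions are taken relative to the ambient space of algebraic curvature
  tensors (with its Euclidean distance).\<close>
definition rel_boundary :: "('n::finite) tensor4 set \<Rightarrow> 'n tensor4 set" where
  "rel_boundary F = {R. alg_curv R \<and>
      (\<forall>\<epsilon>>0. (\<exists>X\<in>F. tdist X R < \<epsilon>) \<and> (\<exists>W. alg_curv W \<and> W \<notin> F \<and> tdist W R < \<epsilon>))}"

definition tangent_cone :: "('n::finite) tensor4 set \<Rightarrow> 'n tensor4 \<Rightarrow> 'n tensor4 set" where
  "tangent_cone F R = {V. \<forall>\<epsilon>>0. \<exists>X\<in>F. \<exists>c\<ge>0::real.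
      tdist (\<lambda>i j k l. c * (X i j k l - R i j k l)) V < \<epsilon>}"

definition rel_interior_act :: "('n::finite) tensor4 set \<Rightarrow> 'n tensor4 set" where
  "rel_interior_act F = {V. alg_curv V \<and> (\<exists>\<epsilon>>0. \<forall>W. alg_curv W \<longrightarrow> tdist W V < \<epsilon> \<longrightarrow> W \<in> F)}"

definition transversally_invariant :: "('n::finite) tensor4 set \<Rightarrow> bool" where
  "transversally_invariant F \<longleftrightarrow>
     (\<forall>R\<in>rel_boundary F. R \<noteq> (\<lambda>i j k l. 0) \<longrightarrow> Qop R \<in> rel_interior_act (tangent_cone F R))"

definition admissible_thetabar :: "'n::finite itself \<Rightarrow> real \<Rightarrow> bool" where
  "admissible_thetabar TYPE('n) tb \<longleftrightarrow> 0 < tb \<and>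
     (\<forall>\<sigma> \<theta>. 0 < \<sigma> \<and> \<sigma> \<le> 2 \<and> 0 \<le> \<theta> \<and> \<theta> \<le> tb \<longrightarrow> ode_invariant (cone_C \<sigma> \<theta> :: 'n tensor4 set)) \<and>
     (\<forall>\<sigma> \<theta>. ((0 < \<sigma> \<and> \<sigma> < 1) \<or> (1 < \<sigma> \<and> \<sigma> < 2)) \<and> 0 < \<theta> \<and> \<theta> < tb \<longrightarrow>
         transversally_invariant (cone_C \<sigma> \<theta> :: 'n tensor4 set))"

definition cone_f :: "(real \<Rightarrow> real) \<Rightarrow> real \<Rightarrow> ('n::finite) tensor4 set" where
  "cone_f f \<theta> = {R. \<exists>S H. S \<in> PIC2 \<and> sym_form H \<and> ric0 S = (\<lambda>i k. 0) \<and>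
      R = (\<lambda>i j k l. S i j k l + kn H idf i j k l) \<and>
      psd (\<lambda>i j. f (trf H) * idf i j - H i j) \<and>
      0 \<le> trf H - \<theta> * scal S}"

end

theory Submission
  imports Defs
begin

text \<open>Write \<open>C a\<close> for the cone with \<open>H \<le> a tr(H)\<close>, so that \<open>a = 1/(n - 2\<sigma>)\<close> in the notation of the
  paper. Transversality and compactness give, locally uniformly in \<open>a > 1/(n - 2)\<close>, a scale-invariant
  gain \<open>\<eta>\<close>: moving from \<open>R \<in> C a\<close> in the direction \<open>Q(R)\<close>, the inequality \<open>H \<le> a tr(H)\<close> becomes strict
  by a definite amount. Hence the set defined by a concave \<open>f\<close> is preserved as soon as
  \<open>f s / s - f' s \<le> \<eta> (f s / s)\<close>, since the slope defect of \<open>f\<close> against the line through the origin is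
  then paid for by the gain. Such an \<open>f\<close> can bend from slope \<open>1/(n - 2\<sigma>0)\<close> to slope \<open>1/(n - 2)\<close> over
  an infinite (logarithmic) range of \<open>s\<close>. Near \<open>R = 0\<close>, where transversality says nothing, the set
  agrees with the invariant cone \<open>C (1/(n - 2\<sigma>0))\<close>.\<close>

section \<open>Quadratic forms and traces\<close>

text \<open>Transversality is a statement about one boundary point and its tangent cone, whereas the
  set defined by \<open>f\<close> meets a continuum of cones. It is therefore first turned into
  finite steps R + \<tau> V that tolerate errors in V, and only then made uniform by compactness.
  Hence \<open>f\<close> is a recursively built polygon, and invariance is proved without
  derivatives of \<open>f\<close>, by excluding a first exit time. A further obstacle is that R does
  not determine (S, H): every argument follows one chosen pair, and the comparison cone at R is the
  one whose line agrees with \<open>f\<close> at tr(H) for that pair.\<close>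

definition qform :: "('n::finite) form2 \<Rightarrow> ('n \<Rightarrow> real) \<Rightarrow> real" where
  "qform H v = (\<Sum>i\<in>UNIV. \<Sum>j\<in>UNIV. H i j * v i * v j)"

definition form_le :: "('n::finite) form2 \<Rightarrow> real \<Rightarrow> bool" where
  "form_le H x \<longleftrightarrow> (\<forall>v. qform H v \<le> x * (\<Sum>i\<in>UNIV. (v i)\<^sup>2))"

lemma sum_idf_mult [simp]:
  "(\<Sum>j\<in>UNIV. idf i j * g j) = g i" "(\<Sum>j\<in>UNIV. idf j i * g j) = g i"
  "(\<Sum>j\<in>UNIV. g j * idf i j) = g i" "(\<Sum>j\<in>UNIV. g j * idf j i) = g i"
  by (simp_all add: idf_def if_distrib if_distribR cong: if_cong)

lemma idf_commute: "idf i j = idf j i"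
  by (simp add: idf_def)

lemma idf_self [simp]: "idf i i = 1"
  by (simp add: idf_def)

lemma qform_idf: "qform idf v = (\<Sum>i\<in>UNIV. (v i)\<^sup>2)"
  by (simp add: qform_def power2_eq_square mult.assoc flip: sum_distrib_left)

lemma qform_comb: "qform (\<lambda>i j. x * A i j + y * B i j) v = x * qform A v + y * qform B v"
  by (simp add: qform_def sum.distrib sum_distrib_left algebra_simps)

lemma psd_iff_form_le: "psd (\<lambda>i j. x * idf i j - H i j) \<longleftrightarrow> form_le H x"
  using qform_comb[of x idf "-1" H]
  by (simp add: psd_def form_le_def qform_idf flip: qform_def)

lemma form_le_mono: "form_le H x \<Longrightarrow> x \<le> y \<Longrightarrow> form_le H y"
  unfolding form_le_def by (meson mult_right_mono order_trans sum_nonneg zero_le_power2)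

lemma form_le_comb:
  assumes "form_le A p" "form_le B q" "0 \<le> x" "0 \<le> y"
  shows "form_le (\<lambda>i j. x * A i j + y * B i j) (x * p + y * q)"
  unfolding form_le_def qform_comb
proof
  fix v :: "'a \<Rightarrow> real"
  have "x * qform A v + y * qform B v
      \<le> x * (p * (\<Sum>i\<in>UNIV. (v i)\<^sup>2)) + y * (q * (\<Sum>i\<in>UNIV. (v i)\<^sup>2))"
    using assms by (intro add_mono mult_left_mono) (auto simp: form_le_def)
  then show "x * qform A v + y * qform B v \<le> (x * p + y * q) * (\<Sum>i\<in>UNIV. (v i)\<^sup>2)"
    by (simp add: algebra_simps)
qed

lemma form_le_idf: "form_le idf 1"
  by (simp add: form_le_def qform_idf)

lemma form_le_limit:
  assumes "\<And>m. form_le (H m) (x m)" "\<And>i j. (\<lambda>m. H m i j) \<longlonglongrightarrow> G i j" "x \<longlonglongrightarrow> y"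
  shows "form_le G y"
  unfolding form_le_def
proof
  fix v
  have "(\<lambda>m. qform (H m) v) \<longlonglongrightarrow> qform G v"
    unfolding qform_def by (intro tendsto_intros assms)
  moreover have "(\<lambda>m. x m * (\<Sum>i\<in>UNIV. (v i)\<^sup>2)) \<longlonglongrightarrow> y * (\<Sum>i\<in>UNIV. (v i)\<^sup>2)"
    by (intro tendsto_intros assms)
  ultimately show "qform G v \<le> y * (\<Sum>i\<in>UNIV. (v i)\<^sup>2)"
    by (rule LIMSEQ_le) (use assms(1) in \<open>auto simp: form_le_def\<close>)
qed

text \<open>Bounding v_i v_j by the mean of the two squares makes each square appear with total
  weight n.\<close>

lemma form_le_entries:
  fixes H :: "('n::finite) form2"
  assumes "\<And>i j. \<bar>H i j\<bar> \<le> e"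
  shows "form_le H (real CARD('n) * e)"
  unfolding form_le_def
proof
  fix v :: "'n \<Rightarrow> real"
  have "e \<ge> 0" using assms[of undefined undefined] by linarith
  have "qform H v \<le> (\<Sum>i\<in>UNIV. \<Sum>j\<in>UNIV. e * (((v i)\<^sup>2 + (v j)\<^sup>2) / 2))"
    unfolding qform_def
  proof (intro sum_mono)
    fix i j
    have "\<bar>v i * v j\<bar> \<le> ((v i)\<^sup>2 + (v j)\<^sup>2) / 2"
      using sum_squares_bound[of "\<bar>v i\<bar>" "\<bar>v j\<bar>"] by (simp add: abs_mult)
    then have "\<bar>H i j\<bar> * \<bar>v i * v j\<bar> \<le> e * (((v i)\<^sup>2 + (v j)\<^sup>2) / 2)"
      using assms \<open>e \<ge> 0\<close> by (intro mult_mono) auto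
    moreover have "H i j * v i * v j \<le> \<bar>H i j\<bar> * \<bar>v i * v j\<bar>"
      using abs_ge_self[of "H i j * (v i * v j)"] by (simp add: abs_mult mult.assoc)
    ultimately show "H i j * v i * v j \<le> e * (((v i)\<^sup>2 + (v j)\<^sup>2) / 2)"
      by linarith
  qed
  also have "\<dots> = real CARD('n) * e * (\<Sum>i\<in>UNIV. (v i)\<^sup>2)"
    by (simp add: sum.distrib add_divide_distrib distrib_left flip: sum_distrib_left sum_divide_distrib)
  finally show "qform H v \<le> real CARD('n) * e * (\<Sum>i\<in>UNIV. (v i)\<^sup>2)" .
qed

lemma trf_comb: "trf (\<lambda>i j. x * A i j + y * B i j) = x * trf A + y * trf B"
  by (simp add: trf_def sum.distrib sum_distrib_left)

lemma trf_idf: "trf (idf :: ('n::finite) form2) = real CARD('n)"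
  by (simp add: trf_def)

section \<open>Contractions, and the curvature symmetries of products with the identity\<close>

lemma ric_comb:
  "ric (\<lambda>i j k l. x * A i j k l + y * B i j k l) = (\<lambda>i k. x * ric A i k + y * ric B i k)"
  by (simp add: ric_def sum.distrib sum_distrib_left fun_eq_iff)

lemma scal_comb:
  "scal (\<lambda>i j k l. x * A i j k l + y * B i j k l) = x * scal A + y * scal B"
  by (simp add: scal_def ric_comb sum.distrib sum_distrib_left)

lemma ric0_comb:
  "ric0 (\<lambda>i j k l. x * A i j k l + y * B i j k l) = (\<lambda>i k. x * ric0 A i k + y * ric0 B i k)"
  by (simp add: ric0_def ric_comb scal_comb fun_eq_iff algebra_simps add_divide_distrib)

lemma kn_comb:
  "kn (\<lambda>i j. x * A i j + y * B i j) C i j k l = x * kn A C i j k l + y * kn B C i j k l"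
  by (simp add: kn_def algebra_simps)

lemma ric_kn_idf:
  fixes H :: "('n::finite) form2"
  shows "ric (kn H idf) i k = (real CARD('n) - 2) * H i k + trf H * idf i k"
proof -
  have "ric (kn H idf) i k
      = (\<Sum>j\<in>(UNIV::'n set). H i k) - (\<Sum>j\<in>UNIV. H i j * idf j k)
        - (\<Sum>j\<in>UNIV. H j k * idf i j) + (\<Sum>j\<in>UNIV. H j j) * idf i k"
    unfolding ric_def kn_def sum.distrib sum_subtractf sum_distrib_right by simp
  then show ?thesis
    by (simp add: trf_def algebra_simps)
qed

lemma scal_kn_idf:
  fixes H :: "('n::finite) form2"
  shows "scal (kn H idf) = 2 * (real CARD('n) - 1) * trf H"
  by (simp add: scal_def ric_kn_idf sum.distrib flip: sum_distrib_left trf_def)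
    (simp add: algebra_simps)

text \<open>Up to the factor n - 2, the map \<open>ric0\<close> undoes H -> \<open>kn H idf\<close>
  on trace-free forms. This allows a trace-free Ricci part to be moved into H, and H to be read off
  from R up to its trace.\<close>

lemma ric0_kn_idf:
  fixes H :: "('n::finite) form2"
  shows "ric0 (kn H idf) i k = (real CARD('n) - 2) * (H i k - trf H / real CARD('n) * idf i k)"
  by (simp add: ric0_def ric_kn_idf scal_kn_idf field_simps)

lemma alg_curv_comb:
  assumes "alg_curv A" "alg_curv B"
  shows "alg_curv (\<lambda>i j k l. x * A i j k l + y * B i j k l)"
  unfolding alg_curv_def
proof (intro allI conjI)
  fix i j k l
  have a: "A i j k l = - A j i k l" "A i j k l = A k l i j" "A i j k l = - A j k i l - A k i j l"
    using assms(1) unfolding alg_curv_def by (blast, blast) (smt (verit) assms(1) alg_curv_def)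
  have b: "B i j k l = - B j i k l" "B i j k l = B k l i j" "B i j k l = - B j k i l - B k i j l"
    using assms(2) unfolding alg_curv_def by (blast, blast) (smt (verit) assms(2) alg_curv_def)
  show "x * A i j k l + y * B i j k l = - (x * A j i k l + y * B j i k l)"
    unfolding a(1) b(1) by simp
  show "x * A i j k l + y * B i j k l = x * A k l i j + y * B k l i j"
    unfolding a(2) b(2) by simp
  show "x * A i j k l + y * B i j k l + (x * A j k i l + y * B j k i l)
      + (x * A k i j l + y * B k i j l) = 0"
    unfolding a(3) b(3) by (simp add: algebra_simps)
qed

lemma alg_curv_kn_idf:
  assumes "sym_form H"
  shows "alg_curv (kn H idf)"
  unfolding alg_curv_def
proof (intro allI conjI)
  fix i j k l
  have h: "H p q = H q p" for p q
    using assms by (simp add: sym_form_def)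
  show "kn H idf i j k l = - kn H idf j i k l"
    by (simp add: kn_def)
  show "kn H idf i j k l = kn H idf k l i j"
    by (simp add: kn_def h[of k] h[of l j] h[of l i] idf_commute[of k] idf_commute[of l j] idf_commute[of l i])
  show "kn H idf i j k l + kn H idf j k i l + kn H idf k i j l = 0"
    by (simp add: kn_def h[of k i] h[of k j] h[of j i] idf_commute[of k i] idf_commute[of k j]
        idf_commute[of j i])
qed

lemma alg_curvD:
  assumes "alg_curv R"
  shows "R i j k l = - R j i k l" "R i j k l = - R i j l k" "R i j k l = R k l i j"
  using assms unfolding alg_curv_def by metis+

lemma sym_ric0: "alg_curv R \<Longrightarrow> sym_form (ric0 R)"
  unfolding sym_form_def ric0_def ric_def
  by (auto simp: idf_commute intro!: sum.cong dest: alg_curvD(3))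

lemma trf_ric0: "trf (ric0 R) = 0"
  by (simp add: trf_def ric0_def sum_subtractf scal_def)

section \<open>PIC2 as a closed convex cone, and continuity of the contractions and of Q\<close>

lemma cval_comb:
  "cval (\<lambda>i j k l. x * A i j k l + y * B i j k l) z w
    = of_real x * cval A z w + of_real y * cval B z w"
  by (simp add: cval_def sum.distrib sum_distrib_left algebra_simps)

lemma PIC2_comb:
  assumes "A \<in> PIC2" "B \<in> PIC2" "0 \<le> x" "0 \<le> y"
  shows "(\<lambda>i j k l. x * A i j k l + y * B i j k l) \<in> PIC2"
  using assms by (simp add: PIC2_def alg_curv_comb cval_comb)

lemma cval_idf: "cval R (\<lambda>a. of_real (idf i a)) (\<lambda>b. of_real (idf j b)) = of_real (R i j i j)"
proof -
  have "cval R (\<lambda>a. of_real (idf i a)) (\<lambda>b. of_real (idf j b)) =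
    of_real (\<Sum>a\<in>UNIV. \<Sum>b\<in>UNIV. \<Sum>k\<in>UNIV. \<Sum>l\<in>UNIV. R a b k l * idf i a * idf j b * idf i k * idf j l)"
    by (simp only: cval_def of_real_sum of_real_mult complex_cnj_complex_of_real)
  also have "(\<Sum>a\<in>UNIV. \<Sum>b\<in>UNIV. \<Sum>k\<in>UNIV. \<Sum>l\<in>UNIV. R a b k l * idf i a * idf j b * idf i k * idf j l) = R i j i j"
    by (simp flip: sum_distrib_right)
  finally show ?thesis .
qed

text \<open>Coordinate vectors for z and w give nonnegative sectional curvatures R_ijij, and scal is
  their sum.\<close>

lemma PIC2_scal_nonneg:
  assumes "R \<in> PIC2"
  shows "0 \<le> scal R"
proof -
  have "0 \<le> Re (cval R (\<lambda>a. of_real (idf i a)) (\<lambda>b. of_real (idf j b)))" for i j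
    using assms by (simp add: PIC2_def)
  then have "0 \<le> R i j i j" for i j
    by (simp add: cval_idf)
  then show ?thesis
    by (simp add: scal_def ric_def sum_nonneg)
qed

lemma alg_curv_limit:
  assumes "\<And>m. alg_curv (S m)" "\<And>i j k l. (\<lambda>m. S m i j k l) \<longlonglongrightarrow> R i j k l"
  shows "alg_curv R"
  unfolding alg_curv_def
proof (intro allI conjI)
  fix i j k l
  have "(\<lambda>m. - S m j i k l) \<longlonglongrightarrow> - R j i k l" "(\<lambda>m. S m k l i j) \<longlonglongrightarrow> R k l i j"
    by (intro tendsto_minus assms)+
  moreover have "(\<lambda>m. - S m j i k l) = (\<lambda>m. S m i j k l)" "(\<lambda>m. S m k l i j) = (\<lambda>m. S m i j k l)"
    by (rule ext, metis assms(1) alg_curvD(1), rule ext, metis assms(1) alg_curvD(3))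
  ultimately show "R i j k l = - R j i k l" "R i j k l = R k l i j"
    by (metis LIMSEQ_unique assms(2))+
  have "(\<lambda>m. S m i j k l + S m j k i l + S m k i j l) \<longlonglongrightarrow> R i j k l + R j k i l + R k i j l"
    by (intro tendsto_intros assms)
  moreover have "(\<lambda>m. S m i j k l + S m j k i l + S m k i j l) = (\<lambda>m. 0)"
    using assms(1) unfolding alg_curv_def by blast
  ultimately show "R i j k l + R j k i l + R k i j l = 0"
    by (simp add: LIMSEQ_const_iff)
qed

lemma PIC2_limit:
  assumes "\<And>m. S m \<in> PIC2" "\<And>i j k l. (\<lambda>m. S m i j k l) \<longlonglongrightarrow> R i j k l"
  shows "R \<in> PIC2"
proof -
  have "alg_curv R"
    by (rule alg_curv_limit[of S]) (use assms in \<open>auto simp: PIC2_def\<close>)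
  moreover have "Im (cval R z w) = 0 \<and> 0 \<le> Re (cval R z w)" for z w
  proof -
    have l: "(\<lambda>m. cval (S m) z w) \<longlonglongrightarrow> cval R z w"
      unfolding cval_def by (intro tendsto_intros assms)
    have "(\<lambda>m. Im (cval (S m) z w)) = (\<lambda>m. 0)" "\<forall>m. 0 \<le> Re (cval (S m) z w)"
      using assms(1) by (auto simp: PIC2_def)
    with tendsto_Im[OF l] LIMSEQ_le_const[OF tendsto_Re[OF l]] show ?thesis
      by (auto simp: LIMSEQ_const_iff)
  qed
  ultimately show ?thesis by (simp add: PIC2_def)
qed

lemma scal_limit:
  assumes "\<And>i j k l. (\<lambda>m. S m i j k l) \<longlonglongrightarrow> R i j k l"
  shows "(\<lambda>m. scal (S m)) \<longlonglongrightarrow> scal R"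
  unfolding scal_def ric_def by (intro tendsto_intros assms)

lemma ric0_limit:
  assumes "\<And>i j k l. (\<lambda>m. S m i j k l) \<longlonglongrightarrow> R i j k l"
  shows "(\<lambda>m. ric0 (S m) i k) \<longlonglongrightarrow> ric0 R i k"
  unfolding ric0_def ric_def by (intro tendsto_intros scal_limit assms) auto

lemma Qop_limit:
  assumes "\<And>i j k l. (\<lambda>m. S m i j k l) \<longlonglongrightarrow> R i j k l"
  shows "(\<lambda>m. Qop (S m) i j k l) \<longlonglongrightarrow> Qop R i j k l"
  unfolding Qop_def Bop_def by (intro tendsto_intros assms)

lemma Qop_scale: "Qop (\<lambda>i j k l. c * R i j k l) i j k l = c\<^sup>2 * Qop R i j k l"
  by (simp add: Qop_def Bop_def sum_distrib_left algebra_simps power2_eq_square)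

section \<open>Decompositions of curvature tensors\<close>

text \<open>Contains every condition except the upper bound on H, so that the cones of all slopes
  and the set defined by \<open>f\<close> share one theory of decompositions.\<close>

definition decomp :: "real \<Rightarrow> ('n::finite) tensor4 \<Rightarrow> 'n tensor4 \<Rightarrow> 'n form2 \<Rightarrow> bool" where
  "decomp \<theta> R S H \<longleftrightarrow> S \<in> PIC2 \<and> sym_form H \<and> ric0 S = (\<lambda>i k. 0) \<and>
     R = (\<lambda>i j k l. S i j k l + kn H idf i j k l) \<and> 0 \<le> trf H - \<theta> * scal S"

lemma cone_f_iff: "R \<in> cone_f f \<theta> \<longleftrightarrow> (\<exists>S H. decomp \<theta> R S H \<and> form_le H (f (trf H)))"
  unfolding cone_f_def decomp_def psd_iff_form_le by blast

lemma decomp_comb: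
  assumes "decomp \<theta> R S H" "decomp \<theta> R' S' H'" "0 \<le> x" "0 \<le> y"
  shows "decomp \<theta> (\<lambda>i j k l. x * R i j k l + y * R' i j k l)
           (\<lambda>i j k l. x * S i j k l + y * S' i j k l) (\<lambda>i j. x * H i j + y * H' i j)"
proof -
  have "0 \<le> x * (trf H - \<theta> * scal S) + y * (trf H' - \<theta> * scal S')"
    using assms by (intro add_nonneg_nonneg mult_nonneg_nonneg) (auto simp: decomp_def)
  then have "0 \<le> trf (\<lambda>i j. x * H i j + y * H' i j)
      - \<theta> * scal (\<lambda>i j k l. x * S i j k l + y * S' i j k l)"
    by (simp add: trf_comb scal_comb algebra_simps)
  then show ?thesis
    using assms by (simp add: decomp_def PIC2_comb ric0_comb kn_comb sym_form_def)
      (simp add: algebra_simps)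
qed

text \<open>The added multiple of the round tensor goes into H alone: S is untouched and tr(H) only
  grows. This shift later produces the strict bound on H.\<close>

lemma decomp_shift:
  assumes "decomp \<theta> R S H" "0 \<le> c"
  shows "decomp \<theta> (\<lambda>i j k l. R i j k l + c * kn idf idf i j k l) S (\<lambda>i j. H i j + c * idf i j)"
  using assms trf_comb[of 1 H c idf] kn_comb[of 1 H c idf]
  by (auto simp: decomp_def sym_form_def idf_commute trf_idf add.assoc intro: add_increasing2)

lemma decomp_alg_curv: "decomp \<theta> R S H \<Longrightarrow> alg_curv R"
  using alg_curv_comb[of S "kn H idf" 1 1]
  by (simp add: decomp_def PIC2_def alg_curv_kn_idf)

lemma decomp_trf_nonneg:
  assumes "decomp \<theta> R S H" "0 \<le> \<theta>"
  shows "0 \<le> trf H"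
proof -
  have "0 \<le> \<theta> * scal S" "0 \<le> trf H - \<theta> * scal S"
    using assms by (auto simp: decomp_def PIC2_scal_nonneg)
  then show ?thesis by linarith
qed

text \<open>In scal R = scal S + 2(n - 1) tr(H) the first summand is nonnegative. With tr(H) \<ge> 0
  this bounds all traces that are possible for a given R.\<close>

lemma decomp_trf_le:
  fixes R :: "('n::finite) tensor4"
  assumes "decomp \<theta> R S H"
  shows "2 * (real CARD('n) - 1) * trf H \<le> scal R"
  using assms PIC2_scal_nonneg[of S] scal_comb[of 1 S 1 "kn H idf"]
  by (simp add: decomp_def scal_kn_idf)

lemma decomp_form_eq:
  fixes R :: "('n::finite) tensor4"
  assumes "decomp \<theta> R S H" "2 < CARD('n)"
  shows "H i k = ric0 R i k / (real CARD('n) - 2) + trf H / real CARD('n) * idf i k"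
proof -
  have "ric0 R i k = (real CARD('n) - 2) * (H i k - trf H / real CARD('n) * idf i k)"
    using assms(1) ric0_comb[of 1 S 1 "kn H idf"] by (simp add: decomp_def ric0_kn_idf)
  then show ?thesis
    using assms(2) by (simp add: field_simps)
qed

lemma bounded_real_subsequence:
  fixes x :: "nat \<Rightarrow> real"
  assumes "\<And>m. a \<le> x m" "\<And>m. x m \<le> b"
  obtains r y where "strict_mono (r :: nat \<Rightarrow> nat)" "(x \<circ> r) \<longlonglongrightarrow> y" "a \<le> y" "y \<le> b"
proof -
  have "\<forall>m. x m \<in> {a..b}" using assms by simp
  then obtain y r where "y \<in> {a..b}" "strict_mono (r :: nat \<Rightarrow> nat)" "(x \<circ> r) \<longlonglongrightarrow> y"
    using compact_Icc[of a b] unfolding compact_eq_seq_compact_metric seq_compact_def by metis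
  then show thesis using that by auto
qed

text \<open>The decomposition is not unique, but its only freedom is the trace of \<open>H\<close>, which is
  squeezed between \<open>0\<close> and a multiple of the scalar curvature.\<close>

lemma decomp_limit:
  fixes R :: "('n::finite) tensor4"
  assumes n: "2 < CARD('n)" and th: "0 \<le> \<theta>"
    and d: "\<And>m. decomp \<theta> (X m) (S m) (H m)"
    and l: "\<And>i j k l. (\<lambda>m. X m i j k l) \<longlonglongrightarrow> R i j k l"
  obtains r S' H' where "strict_mono (r :: nat \<Rightarrow> nat)" "decomp \<theta> R S' H'"
    "\<And>i j. (\<lambda>m. H (r m) i j) \<longlonglongrightarrow> H' i j"
proof -
  obtain B where "\<And>m. norm (scal (X m)) \<le> B"
    using convergent_imp_Bseq[OF convergentI[OF scal_limit[of X R, OF l]]] unfolding Bseq_def by blast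
  then have B: "scal (X m) \<le> B" for m
    by (auto intro: abs_le_D1)
  have "trf (H m) \<le> B / (2 * (real CARD('n) - 1))" for m
    using decomp_trf_le[OF d[of m]] B[of m] n by (simp add: field_simps)
  then obtain r y where r: "strict_mono (r :: nat \<Rightarrow> nat)" and y: "((\<lambda>m. trf (H m)) \<circ> r) \<longlonglongrightarrow> y"
    using bounded_real_subsequence[of 0 "\<lambda>m. trf (H m)"] decomp_trf_nonneg[OF d th] by metis
  have l': "(\<lambda>m. X (r m) i j k l) \<longlonglongrightarrow> R i j k l" for i j k l
    using LIMSEQ_subseq_LIMSEQ[OF l r] by (simp add: o_def)
  define H' where "H' i k = ric0 R i k / (real CARD('n) - 2) + y / real CARD('n) * idf i k" for i k
  have H': "(\<lambda>m. H (r m) i k) \<longlonglongrightarrow> H' i k" for i k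
    unfolding H'_def decomp_form_eq[OF d n, of _ i k]
    using n y by (intro tendsto_intros ric0_limit l') (auto simp: o_def)
  define S' where "S' i j k l = R i j k l - kn H' idf i j k l" for i j k l
  have "S (r m) i j k l = X (r m) i j k l - kn (H (r m)) idf i j k l" for m i j k l
    using d[of "r m"] by (simp add: decomp_def)
  then have S': "(\<lambda>m. S (r m) i j k l) \<longlonglongrightarrow> S' i j k l" for i j k l
    unfolding S'_def kn_def by simp (intro tendsto_intros l' H')
  have "S' \<in> PIC2"
    by (rule PIC2_limit[of "\<lambda>m. S (r m)", OF _ S']) (use d in \<open>auto simp: decomp_def\<close>)
  moreover have "sym_form H'"
    unfolding sym_form_def
  proof (intro allI)
    fix i j
    have "(\<lambda>m. H (r m) j i) = (\<lambda>m. H (r m) i j)"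
      using d unfolding decomp_def sym_form_def by metis
    then show "H' i j = H' j i"
      using H'[of i j] H'[of j i] LIMSEQ_unique by metis
  qed
  moreover have "ric0 S' i k = 0" for i k
    using ric0_limit[of "\<lambda>m. S (r m)" S' i k, OF S'] d by (simp add: decomp_def LIMSEQ_const_iff)
  moreover have "0 \<le> trf H' - \<theta> * scal S'"
  proof (rule LIMSEQ_le_const)
    show "(\<lambda>m. trf (H (r m)) - \<theta> * scal (S (r m))) \<longlonglongrightarrow> trf H' - \<theta> * scal S'"
      unfolding trf_def by (intro tendsto_intros H' scal_limit S')
  qed (use d in \<open>auto simp: decomp_def\<close>)
  moreover have "R = (\<lambda>i j k l. S' i j k l + kn H' idf i j k l)"
    by (simp add: S'_def)
  ultimately have "decomp \<theta> R S' H'"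
    by (simp add: decomp_def fun_eq_iff)
  with r H' show thesis using that by blast
qed

text \<open>Serves both as closedness of the set for one function and for limits of cones whose
  slope varies with m. Subsequences enter the hypothesis on \<open>f\<close> because decompositions
  converge only along a subsequence.\<close>

lemma cone_f_limit:
  fixes R :: "('n::finite) tensor4"
  assumes n: "2 < CARD('n)" and th: "0 \<le> \<theta>"
    and X: "\<And>m. X m \<in> cone_f (f m) \<theta>"
    and l: "\<And>i j k l. (\<lambda>m. X m i j k l) \<longlonglongrightarrow> R i j k l"
    and f: "\<And>x y (r :: nat \<Rightarrow> nat). strict_mono r \<Longrightarrow> x \<longlonglongrightarrow> y \<Longrightarrow> (\<And>m. 0 \<le> x m) \<Longrightarrow>
              (\<lambda>m. f (r m) (x m)) \<longlonglongrightarrow> g y"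
  shows "R \<in> cone_f g \<theta>"
proof -
  obtain S H where d: "\<And>m. decomp \<theta> (X m) (S m) (H m)" and le: "\<And>m. form_le (H m) (f m (trf (H m)))"
    using X unfolding cone_f_iff by metis
  obtain r S' H' where r: "strict_mono (r :: nat \<Rightarrow> nat)" and d': "decomp \<theta> R S' H'"
    and H': "\<And>i j. (\<lambda>m. H (r m) i j) \<longlonglongrightarrow> H' i j"
    using decomp_limit[OF n th d l] by blast
  have "(\<lambda>m. trf (H (r m))) \<longlonglongrightarrow> trf H'"
    unfolding trf_def by (intro tendsto_intros H')
  then have "(\<lambda>m. f (r m) (trf (H (r m)))) \<longlonglongrightarrow> g (trf H')"
    using f[OF r] decomp_trf_nonneg[OF d th] by blast
  then have "form_le H' (g (trf H'))"
    using le H' by (rule_tac form_le_limit[of "\<lambda>m. H (r m)"]) auto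
  with d' show ?thesis unfolding cone_f_iff by blast
qed

lemma cone_f_linear_comb:
  assumes "X \<in> cone_f (\<lambda>s. a * s) \<theta>" "Y \<in> cone_f (\<lambda>s. a * s) \<theta>" "0 \<le> x" "0 \<le> y"
  shows "(\<lambda>i j k l. x * X i j k l + y * Y i j k l) \<in> cone_f (\<lambda>s. a * s) \<theta>"
proof -
  obtain S H S' H' where *: "decomp \<theta> X S H" "form_le H (a * trf H)"
    "decomp \<theta> Y S' H'" "form_le H' (a * trf H')"
    using assms(1,2) unfolding cone_f_iff by blast
  have "form_le (\<lambda>i j. x * H i j + y * H' i j) (a * trf (\<lambda>i j. x * H i j + y * H' i j))"
    using form_le_comb[OF *(2,4) assms(3,4)] by (simp add: trf_comb algebra_simps)
  then show ?thesis
    using decomp_comb[OF *(1,3) assms(3,4)] unfolding cone_f_iff by blast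
qed

lemma cone_C_eq_cone_f:
  assumes "2 * \<sigma> < real CARD('n)"
  shows "(cone_C \<sigma> \<theta> :: ('n::finite) tensor4 set) = cone_f (\<lambda>s. 1 / (real CARD('n) - 2 * \<sigma>) * s) \<theta>"
proof -
  let ?n = "real CARD('n) - 2 * \<sigma>"
  have "psd (\<lambda>i j. trf H * idf i j - ?n * H i j)
      \<longleftrightarrow> psd (\<lambda>i j. 1 / ?n * trf H * idf i j - H i j)" for H :: "'n form2"
  proof -
    have e: "trf H * idf i j - ?n * H i j = ?n * (1 / ?n * trf H * idf i j - H i j)" for i j
      using assms by (simp add: field_simps)
    have "(\<Sum>i\<in>UNIV. \<Sum>j\<in>UNIV. (trf H * idf i j - ?n * H i j) * v i * v j)
        = ?n * (\<Sum>i\<in>UNIV. \<Sum>j\<in>UNIV. (1 / ?n * trf H * idf i j - H i j) * v i * v j)" for v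
      unfolding e sum_distrib_left by (simp only: mult.assoc)
    then show ?thesis
      using assms unfolding psd_def by (simp only: zero_le_mult_iff) auto
  qed
  then show ?thesis unfolding cone_C_def cone_f_def by simp
qed

section \<open>Interior points of the cones\<close>

text \<open>Conjugation exchanges (i, j) with (k, l), which the pair symmetry undoes once the sums
  are reordered. Membership in PIC2 thus only needs the real part.\<close>

lemma cval_real:
  assumes "alg_curv R"
  shows "Im (cval R z w) = 0"
proof -
  have "cnj (cval R z w) = (\<Sum>i\<in>UNIV. \<Sum>j\<in>UNIV. \<Sum>k\<in>UNIV. \<Sum>l\<in>UNIV.
      of_real (R k l i j) * z k * w l * cnj (z i) * cnj (w j))"
    unfolding cval_def cnj_sum
  proof (intro sum.cong refl)
    fix i j k l
    have "R i j k l = R k l i j" using assms by (rule alg_curvD(3))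
    then show "cnj (complex_of_real (R i j k l) * z i * w j * cnj (z k) * cnj (w l)) =
       complex_of_real (R k l i j) * z k * w l * cnj (z i) * cnj (w j)"
      by simp
  qed
  also have "\<dots> = (\<Sum>i\<in>UNIV. \<Sum>k\<in>UNIV. \<Sum>j\<in>UNIV. \<Sum>l\<in>UNIV.
      of_real (R k l i j) * z k * w l * cnj (z i) * cnj (w j))"
    by (intro sum.cong refl sum.swap)
  also have "\<dots> = (\<Sum>k\<in>UNIV. \<Sum>i\<in>UNIV. \<Sum>l\<in>UNIV. \<Sum>j\<in>UNIV.
      of_real (R k l i j) * z k * w l * cnj (z i) * cnj (w j))"
    by (subst sum.swap) (intro sum.cong refl sum.swap)
  also have "\<dots> = cval R z w"
    unfolding cval_def by (intro sum.cong refl sum.swap)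
  finally show ?thesis
    by (simp add: complex_eq_iff)
qed

lemma sum_antisym:
  fixes A :: "'n::finite \<Rightarrow> 'n \<Rightarrow> complex"
  assumes "\<And>i j. A i j = - A j i"
  shows "(\<Sum>i\<in>UNIV. \<Sum>j\<in>UNIV. A i j * (x i * y j))
    = 1/2 * (\<Sum>i\<in>UNIV. \<Sum>j\<in>UNIV. A i j * (x i * y j - x j * y i))"
proof -
  have "(\<Sum>i\<in>UNIV. \<Sum>j\<in>UNIV. A i j * (x j * y i)) = (\<Sum>j\<in>UNIV. \<Sum>i\<in>UNIV. A i j * (x j * y i))"
    by (rule sum.swap)
  also have "\<dots> = (\<Sum>i\<in>UNIV. \<Sum>j\<in>UNIV. - (A i j * (x i * y j)))"
    by (intro sum.cong refl) (subst assms, simp)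
  finally show ?thesis
    by (simp add: right_diff_distrib sum_subtractf sum_negf)
qed

text \<open>By antisymmetry in each index pair the value depends only on the bivector of z and w. A
  perturbation estimate in terms of |z| |w| would be useless for nearly parallel z and w; this form
  permits one in terms of the bivector.\<close>

lemma cval_bivector:
  assumes "alg_curv R"
  shows "cval R z w = 1/4 * (\<Sum>i\<in>UNIV. \<Sum>j\<in>UNIV. \<Sum>k\<in>UNIV. \<Sum>l\<in>UNIV.
    of_real (R i j k l) * (z i * w j - z j * w i) * cnj (z k * w l - z l * w k))"
proof -
  let ?b = "\<lambda>k l. cnj (z k) * cnj (w l) - cnj (z l) * cnj (w k)"
  have in_eq: "(\<Sum>k\<in>UNIV. \<Sum>l\<in>UNIV. complex_of_real (R i j k l) * (cnj (z k) * cnj (w l)))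
      = 1/2 * (\<Sum>k\<in>UNIV. \<Sum>l\<in>UNIV. complex_of_real (R i j k l) * ?b k l)" for i j
    by (rule sum_antisym) (metis assms alg_curvD(2) of_real_minus)
  have "cval R z w = (\<Sum>i\<in>UNIV. \<Sum>j\<in>UNIV.
     (\<Sum>k\<in>UNIV. \<Sum>l\<in>UNIV. complex_of_real (R i j k l) * (cnj (z k) * cnj (w l))) * (z i * w j))"
    unfolding cval_def sum_distrib_right by (intro sum.cong refl) (simp add: mult_ac)
  also have "\<dots> = (\<Sum>i\<in>UNIV. \<Sum>j\<in>UNIV.
     (1/2 * (\<Sum>k\<in>UNIV. \<Sum>l\<in>UNIV. complex_of_real (R i j k l) * ?b k l)) * (z i * w j))"
    unfolding in_eq ..
  also have "\<dots> = 1/2 * (\<Sum>i\<in>UNIV. \<Sum>j\<in>UNIV.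
     (1/2 * (\<Sum>k\<in>UNIV. \<Sum>l\<in>UNIV. complex_of_real (R i j k l) * ?b k l)) * (z i * w j - z j * w i))"
  proof (rule sum_antisym)
    fix i j
    have "complex_of_real (R i j k l) = - complex_of_real (R j i k l)" for k l
      by (metis assms alg_curvD(1) of_real_minus)
    then show "1/2 * (\<Sum>k\<in>UNIV. \<Sum>l\<in>UNIV. complex_of_real (R i j k l) * ?b k l)
        = - (1/2 * (\<Sum>k\<in>UNIV. \<Sum>l\<in>UNIV. complex_of_real (R j i k l) * ?b k l))"
      by (simp only: mult_minus_left sum_negf mult_minus_right)
  qed
  also have "\<dots> = 1/4 * (\<Sum>i\<in>UNIV. \<Sum>j\<in>UNIV. \<Sum>k\<in>UNIV. \<Sum>l\<in>UNIV.
    of_real (R i j k l) * (z i * w j - z j * w i) * cnj (z k * w l - z l * w k))"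
    unfolding sum_distrib_left sum_distrib_right
    by (intro sum.cong refl) (simp add: mult_ac)
  finally show ?thesis .
qed

lemma kn_idf_idf: "kn idf idf i j k l = 2 * (idf i k * idf j l - idf i l * idf j k)"
  by (simp add: kn_def)

text \<open>\<open>kn idf idf\<close> is twice the curvature tensor of the unit sphere; its value is
  the very quantity that controls errors in \<open>norm_cval_le\<close>.\<close>

lemma cval_kn_idf_idf:
  "cval (kn idf idf) z w = of_real (\<Sum>i\<in>UNIV. \<Sum>j\<in>UNIV. (norm (z i * w j - z j * w i))\<^sup>2)"
proof -
  let ?u = "\<lambda>i j. z i * w j - z j * w i"
  have *: "(\<Sum>j\<in>UNIV. complex_of_real (idf i j) * g j) = g i"
    "(\<Sum>j\<in>UNIV. complex_of_real (idf i j) * h * g j) = h * g i" for i g h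
    by (simp_all add: idf_def if_distrib if_distribR cong: if_cong)
  have a: "alg_curv (kn idf idf)"
    by (rule alg_curv_kn_idf) (simp add: sym_form_def idf_commute)
  have inner: "(\<Sum>k\<in>UNIV. \<Sum>l\<in>UNIV. complex_of_real (kn idf idf i j k l) * ?u i j * cnj (?u k l))
     = 4 * of_real ((norm (?u i j))\<^sup>2)" for i j
  proof -
    have "(\<Sum>k\<in>UNIV. \<Sum>l\<in>UNIV. complex_of_real (kn idf idf i j k l) * ?u i j * cnj (?u k l))
      = 2 * ?u i j * ((\<Sum>k\<in>UNIV. of_real (idf i k) * (\<Sum>l\<in>UNIV. of_real (idf j l) * cnj (?u k l)))
         - (\<Sum>k\<in>UNIV. of_real (idf j k) * (\<Sum>l\<in>UNIV. of_real (idf i l) * cnj (?u k l))))"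
      unfolding kn_idf_idf sum_distrib_left sum_subtractf[symmetric]
      by (intro sum.cong refl) (simp add: algebra_simps)
    also have "\<dots> = 4 * (?u i j * cnj (?u i j))"
      unfolding * by (simp add: algebra_simps)
    finally show ?thesis
      by (simp only: complex_norm_square)
  qed
  show ?thesis
    unfolding cval_bivector[OF a] inner by (simp flip: sum_distrib_left)
qed

lemma norm_cval_le:
  fixes W :: "('n::finite) tensor4"
  assumes "alg_curv W" and e: "\<And>i j k l. \<bar>W i j k l\<bar> \<le> e"
  shows "norm (cval W z w)
    \<le> e * (real CARD('n))\<^sup>2 / 4 * (\<Sum>i\<in>UNIV. \<Sum>j\<in>UNIV. (norm (z i * w j - z j * w i))\<^sup>2)"
proof -
  define u where "u i j = z i * w j - z j * w i" for i j
  have "norm (of_real (W i j k l) * u i j * cnj (u k l)) \<le> e * (((norm (u i j))\<^sup>2 + (norm (u k l))\<^sup>2) / 2)"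
    for i j k l
  proof -
    have "norm (of_real (W i j k l) * u i j * cnj (u k l)) = \<bar>W i j k l\<bar> * (norm (u i j) * norm (u k l))"
      by (simp add: norm_mult)
    also have "\<dots> \<le> e * (((norm (u i j))\<^sup>2 + (norm (u k l))\<^sup>2) / 2)"
      using e[of i j k l] sum_squares_bound[of "norm (u i j)" "norm (u k l)"]
      by (intro mult_mono) auto
    finally show ?thesis .
  qed
  then have "norm (\<Sum>i\<in>UNIV. \<Sum>j\<in>UNIV. \<Sum>k\<in>UNIV. \<Sum>l\<in>UNIV. of_real (W i j k l) * u i j * cnj (u k l))
     \<le> (\<Sum>i\<in>UNIV. \<Sum>j\<in>UNIV. \<Sum>k\<in>UNIV. \<Sum>l\<in>UNIV. e * (((norm (u i j))\<^sup>2 + (norm (u k l))\<^sup>2) / 2))"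
    by (intro sum_norm_le)
  also have "\<dots> = e * (real CARD('n))\<^sup>2 * (\<Sum>i\<in>UNIV. \<Sum>j\<in>UNIV. (norm (u i j))\<^sup>2)"
    by (simp add: sum.distrib add_divide_distrib distrib_left power2_eq_square
        flip: sum_distrib_left sum_divide_distrib)
  finally show ?thesis
    unfolding cval_bivector[OF assms(1)] norm_mult u_def[symmetric] by simp
qed

text \<open>The value of the round tensor and the error are measured by the same bivector norm; for
  entries up to 4/n^2 the factor e n^2/4 of the error is at most 1.\<close>

lemma PIC2_interior:
  fixes W :: "('n::finite) tensor4"
  assumes "alg_curv W" and e: "\<And>i j k l. \<bar>W i j k l\<bar> \<le> 4 / (real CARD('n))\<^sup>2"
  shows "(\<lambda>i j k l. kn idf idf i j k l + W i j k l) \<in> PIC2"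
proof -
  have a: "alg_curv (kn idf idf :: 'n tensor4)"
    by (rule alg_curv_kn_idf) (simp add: sym_form_def idf_commute)
  have "norm (cval W z w) \<le> Re (cval (kn idf idf) z w)" for z w
    using norm_cval_le[OF assms] by (simp add: cval_kn_idf_idf)
  then have "0 \<le> Re (cval (kn idf idf) z w) + Re (cval W z w)" for z w
    using abs_Re_le_cmod[of "cval W z w"] by (smt (verit))
  moreover have "alg_curv (\<lambda>i j k l. kn idf idf i j k l + W i j k l)"
    using alg_curv_comb[OF a assms(1), of 1 1] by simp
  ultimately show ?thesis
    using cval_comb[of 1 "kn idf idf" 1 W] by (simp add: PIC2_def cval_real a assms(1))
qed

text \<open>The interior point is a large multiple of the round tensor, one copy of it serving as S
  and the rest as H = t id. The condition 1 < a n says that the identity satisfies H \<le> a tr(H)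
  strictly.\<close>

lemma cone_f_linear_interior:
  fixes a \<theta> :: real
  assumes n: "2 < CARD('n::finite)" and th: "0 \<le> \<theta>" and a: "1 < a * real CARD('n)"
  obtains X :: "('n::finite) tensor4" and e where "0 < e" "alg_curv X"
    "\<forall>W. alg_curv W \<longrightarrow> (\<forall>i j k l. \<bar>W i j k l\<bar> \<le> e) \<longrightarrow>
       (\<lambda>i j k l. X i j k l + W i j k l) \<in> cone_f (\<lambda>s. a * s) \<theta>"
proof -
  define n where "n = real CARD('n)"
  have n3: "3 \<le> n" using n by (simp add: n_def)
  \<comment> \<open>The entries of S below are at most 9 n e = 1/n^2, and the error 2 n^2 e in the
    bound on H is at most 1.\<close>
  define e where "e = 1 / (9 * n^3)"
  have e: "0 < e" using n3 by (simp add: e_def)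
  have e9: "9 * n * e = 1 / n\<^sup>2" using n3 by (simp add: e_def power2_eq_square power3_eq_cube)
  have e2: "2 * n\<^sup>2 * e \<le> 1"
    using n3 by (simp add: e_def power2_eq_square power3_eq_cube)
  \<comment> \<open>The first summand covers \<theta> times scal S1, which is at most 2(n - 1)n + 1;
    the second makes (a n - 1) t \<ge> 1, which covers the error in the bound on H.\<close>
  define t where "t = \<theta> * (2 * (n - 1) * n + 1) + 1 / (a * n - 1)"
  have t0: "0 \<le> t" using th a n3 by (simp add: t_def n_def)
  have t1: "1 \<le> (a * n - 1) * t"
  proof -
    have "0 \<le> (a * n - 1) * (\<theta> * (2 * (n - 1) * n + 1))"
      using th a n3 by (intro mult_nonneg_nonneg) (auto simp: n_def)
    moreover have "(a * n - 1) * (1 / (a * n - 1)) = 1"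
      using a by (simp add: n_def)
    ultimately show ?thesis by (simp only: t_def distrib_left)
  qed
  have t2: "\<theta> * (2 * (n - 1) * n + 1) \<le> n * t"
  proof -
    have "\<theta> * (2 * (n - 1) * n + 1) \<le> t" using a by (simp add: t_def n_def)
    also have "\<dots> \<le> n * t" using mult_right_mono[of 1 n t] n3 t0 by simp
    finally show ?thesis .
  qed
  have sid: "sym_form (idf :: 'n form2)" by (simp add: sym_form_def idf_commute)
  define X :: "'n tensor4" where "X i j k l = (1 + t) * kn idf idf i j k l" for i j k l
  have "alg_curv X"
    using alg_curv_comb[OF alg_curv_kn_idf[OF sid] alg_curv_kn_idf[OF sid], of 1 t]
    by (simp add: X_def[abs_def] algebra_simps)
  moreover have "\<forall>W. alg_curv W \<longrightarrow> (\<forall>i j k l. \<bar>W i j k l\<bar> \<le> e) \<longrightarrow>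
       (\<lambda>i j k l. X i j k l + W i j k l) \<in> cone_f (\<lambda>s. a * s) \<theta>"
  proof (intro allI impI)
    fix W :: "'n tensor4"
    assume W: "alg_curv W" and "\<forall>i j k l. \<bar>W i j k l\<bar> \<le> e"
    then have We: "\<bar>W i j k l\<bar> \<le> e" for i j k l by blast
    \<comment> \<open>G takes the trace-free Ricci part of W into H; the remainder S has vanishing
      \<open>ric0\<close> and is small enough to be added to the round tensor within PIC2.\<close>
    define G where "G i k = ric0 W i k / (n - 2)" for i k
    define S where "S i j k l = W i j k l - kn G idf i j k l" for i j k l
    have ricb: "\<bar>ric W i k\<bar> \<le> n * e" for i k
      using sum_norm_bound[of UNIV "\<lambda>j. W i j k j" e] We by (simp add: ric_def n_def)
    have scalb: "\<bar>scal W\<bar> \<le> n * (n * e)"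
      using sum_norm_bound[of UNIV "\<lambda>i. ric W i i" "n * e"] ricb by (simp add: scal_def n_def)
    have sb: "\<bar>scal W / n * idf i k\<bar> \<le> n * e" for i k
      using scalb n3 e by (simp add: idf_def abs_mult field_simps)
    have "\<bar>ric0 W i k\<bar> \<le> 2 * n * e" for i k
      using ricb[of i k] sb[of i k] unfolding ric0_def n_def by linarith
    moreover have "\<bar>G i k\<bar> \<le> \<bar>ric0 W i k\<bar>" for i k
      using n3 by (simp add: G_def divide_le_eq mult_le_cancel_left1)
    ultimately have Gb: "\<bar>G i k\<bar> \<le> 2 * n * e" for i k
      using order_trans by blast
    have Gi: "\<bar>G i k * idf j l\<bar> \<le> 2 * n * e" for i j k l
      using Gb[of i k] e n3 by (simp add: idf_def)
    have knb: "\<bar>kn G idf i j k l\<bar> \<le> 4 * (2 * n * e)" for i j k l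
      using Gi[of i k j l] Gi[of i l j k] Gi[of j k i l] Gi[of j l i k] unfolding kn_def by linarith
    have "e \<le> n * e" using e n3 by simp
    then have Sb: "\<bar>S i j k l\<bar> \<le> 9 * n * e" for i j k l
      using We[of i j k l] knb[of i j k l] unfolding S_def by linarith
    have trG: "trf G = 0"
      using trf_ric0[of W] by (simp add: G_def[abs_def] trf_def flip: sum_divide_distrib)
    have symG: "sym_form G"
      using sym_ric0[OF W] by (simp add: sym_form_def G_def)
    have S_eq: "S = (\<lambda>i j k l. 1 * W i j k l + (- 1) * kn G idf i j k l)"
      by (simp add: S_def[abs_def])
    have "alg_curv S"
      unfolding S_eq by (intro alg_curv_comb W alg_curv_kn_idf symG)
    moreover have "ric0 S i k = 0" for i k
      unfolding S_eq ric0_comb ric0_kn_idf trG using n3 by (simp add: G_def n_def)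
    moreover have "\<bar>scal S\<bar> \<le> 1"
    proof -
      have "\<bar>ric S i i\<bar> \<le> n * (1 / n\<^sup>2)" for i
        using sum_norm_bound[of UNIV "\<lambda>j. S i j i j" "1 / n\<^sup>2"] Sb e9 by (simp add: ric_def n_def)
      then show ?thesis
        using sum_norm_bound[of UNIV "\<lambda>i. ric S i i" "n * (1 / n\<^sup>2)"] n3
        by (simp add: scal_def n_def power2_eq_square)
    qed
    moreover define S1 where "S1 i j k l = kn idf idf i j k l + S i j k l" for i j k l
    moreover define H1 where "H1 i k = t * idf i k + 1 * G i k" for i k
    ultimately have S: "alg_curv S" "\<And>i k. ric0 S i k = 0" "\<bar>scal S\<bar> \<le> 1" by blast+
    have tr1: "trf H1 = n * t"
      unfolding H1_def[abs_def] trf_comb trf_idf n_def trG by simp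
    have "S1 \<in> PIC2"
      unfolding S1_def[abs_def]
    proof (rule PIC2_interior)
      have "1 / n\<^sup>2 \<le> 4 / n\<^sup>2" by (intro divide_right_mono) auto
      then show "\<bar>S i j k l\<bar> \<le> 4 / (real CARD('n))\<^sup>2" for i j k l
        using Sb[of i j k l] e9 unfolding n_def by linarith
    qed (fact S(1))
    moreover have "sym_form H1"
      using symG by (simp add: H1_def sym_form_def idf_commute)
    moreover have S1_eq: "S1 = (\<lambda>i j k l. 1 * kn idf idf i j k l + 1 * S i j k l)"
      by (simp add: S1_def[abs_def])
    have "ric0 S1 = (\<lambda>i k. 0)"
      unfolding S1_eq ric0_comb ric0_kn_idf S(2) trf_idf by simp
    moreover have "(\<lambda>i j k l. X i j k l + W i j k l) = (\<lambda>i j k l. S1 i j k l + kn H1 idf i j k l)"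
      unfolding H1_def[abs_def] kn_comb by (simp add: X_def S1_def S_def algebra_simps)
    moreover have "0 \<le> trf H1 - \<theta> * scal S1"
    proof -
      have "scal S1 \<le> 2 * (n - 1) * n + 1"
        unfolding S1_eq scal_comb scal_kn_idf trf_idf n_def using S(3) by simp
      then have "\<theta> * scal S1 \<le> \<theta> * (2 * (n - 1) * n + 1)"
        using th by (rule mult_left_mono)
      with t2 show ?thesis by (simp add: tr1)
    qed
    ultimately have "decomp \<theta> (\<lambda>i j k l. X i j k l + W i j k l) S1 H1"
      by (simp add: decomp_def)
    moreover have "form_le H1 (a * trf H1)"
    proof (rule form_le_mono)
      show "form_le H1 (t * 1 + 1 * (n * (2 * n * e)))"
        unfolding H1_def[abs_def] n_def
        by (intro form_le_comb form_le_idf form_le_entries t0 zero_le_one) (use Gb in \<open>simp add: n_def\<close>)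
      show "t * 1 + 1 * (n * (2 * n * e)) \<le> a * trf H1"
        using t1 e2 by (simp add: tr1 algebra_simps power2_eq_square)
    qed
    ultimately show "(\<lambda>i j k l. X i j k l + W i j k l) \<in> cone_f (\<lambda>s. a * s) \<theta>"
      unfolding cone_f_iff by blast
  qed
  ultimately show thesis by (rule that[OF e])
qed

section \<open>Comparison of the Euclidean distance with the largest entry\<close>

lemma entry_le_tdist: "\<bar>A i j k l - B i j k l\<bar> \<le> tdist A B"
proof -
  have "(A i j k l - B i j k l)\<^sup>2 \<le> (\<Sum>l\<in>UNIV. (A i j k l - B i j k l)\<^sup>2)"
    by (rule member_le_sum) auto
  also have "\<dots> \<le> (\<Sum>k\<in>UNIV. \<Sum>l\<in>UNIV. (A i j k l - B i j k l)\<^sup>2)"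
    by (rule member_le_sum) (auto intro!: sum_nonneg)
  also have "\<dots> \<le> (\<Sum>j\<in>UNIV. \<Sum>k\<in>UNIV. \<Sum>l\<in>UNIV. (A i j k l - B i j k l)\<^sup>2)"
    by (rule member_le_sum) (auto intro!: sum_nonneg)
  also have "\<dots> \<le> (\<Sum>i\<in>UNIV. \<Sum>j\<in>UNIV. \<Sum>k\<in>UNIV. \<Sum>l\<in>UNIV. (A i j k l - B i j k l)\<^sup>2)"
    by (rule member_le_sum) (auto intro!: sum_nonneg)
  finally show ?thesis
    unfolding tdist_def by (intro real_le_rsqrt) simp
qed

lemma tdist_le:
  fixes A B :: "('n::finite) tensor4"
  assumes "\<And>i j k l. \<bar>A i j k l - B i j k l\<bar> \<le> e"
  shows "tdist A B \<le> (real CARD('n))\<^sup>2 * e"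
proof -
  have e: "0 \<le> e" using assms[of undefined undefined undefined undefined] by linarith
  have "(A i j k l - B i j k l)\<^sup>2 \<le> e\<^sup>2" for i j k l
    using assms[of i j k l] e by (metis abs_le_square_iff abs_of_nonneg)
  then have "(\<Sum>i\<in>UNIV. \<Sum>j\<in>UNIV. \<Sum>k\<in>UNIV. \<Sum>l\<in>UNIV. (A i j k l - B i j k l)\<^sup>2)
     \<le> (\<Sum>i\<in>(UNIV::'n set). \<Sum>j\<in>(UNIV::'n set). \<Sum>k\<in>(UNIV::'n set). \<Sum>l\<in>(UNIV::'n set). e\<^sup>2)"
    by (intro sum_mono)
  also have "\<dots> = ((real CARD('n))\<^sup>2 * e)\<^sup>2"
    by (simp add: power2_eq_square)
  finally show ?thesis
    unfolding tdist_def using e by (intro real_le_lsqrt) auto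
qed

lemma tensor_bounded:
  obtains M where "0 < M" "\<And>i j k l. \<bar>(A :: ('n::finite) tensor4) i j k l\<bar> \<le> M"
proof
  let ?S = "range (\<lambda>(i, j, k, l). \<bar>A i j k l\<bar>)"
  have *: "\<bar>A i j k l\<bar> \<le> Max ?S" for i j k l
    by (rule Max_ge) (auto intro: range_eqI[of _ _ "(i, j, k, l)"])
  show "\<bar>A i j k l\<bar> \<le> Max ?S + 1" for i j k l
    using *[of i j k l] by linarith
  show "0 < Max ?S + 1"
    using *[of undefined undefined undefined undefined] by linarith
qed

section \<open>Uniform transversality\<close>

lemma alg_curv_diff:
  "alg_curv A \<Longrightarrow> alg_curv B \<Longrightarrow> alg_curv (\<lambda>i j k l. A i j k l - B i j k l)"
  using alg_curv_comb[of A B 1 "-1"] by simp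

lemma cone_f_alg_curv: "R \<in> cone_f f \<theta> \<Longrightarrow> alg_curv R"
  unfolding cone_f_iff using decomp_alg_curv by blast

text \<open>Transversality in terms of the cone itself rather than its tangent cone. At a boundary point
  one pushes \<open>Q(R)\<close> slightly away from an interior point \<open>X\<close>, approximates the result by
  \<open>c (Y - R)\<close> with \<open>Y\<close> in the cone, and absorbs the error into \<open>X\<close>.\<close>

lemma transversal_step:
  fixes R :: "('n::finite) tensor4"
  defines "C a \<theta> \<equiv> cone_f (\<lambda>s. a * s) \<theta> :: 'n tensor4 set"
  assumes n: "2 < CARD('n)" and th: "0 \<le> \<theta>" and a: "1 < a * real CARD('n)"
    and tr: "transversally_invariant (C a \<theta>)"
    and R: "R \<in> C a \<theta>" "R \<noteq> (\<lambda>i j k l. 0)"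
  obtains \<tau> \<epsilon> where "0 < \<tau>" "0 < \<epsilon>"
    "\<forall>V. alg_curv V \<longrightarrow> (\<forall>i j k l. \<bar>V i j k l - Qop R i j k l\<bar> \<le> \<epsilon>) \<longrightarrow>
       (\<lambda>i j k l. R i j k l + \<tau> * V i j k l) \<in> C a \<theta>"
proof (cases "R \<in> rel_boundary (C a \<theta>)")
  case False
  have aR: "alg_curv R" using R(1) unfolding C_def by (rule cone_f_alg_curv)
  have "tdist R R = 0" by (simp add: tdist_def)
  with False R aR obtain \<delta> where \<delta>: "0 < \<delta>" "\<And>W. alg_curv W \<Longrightarrow> tdist W R < \<delta> \<Longrightarrow> W \<in> C a \<theta>"
    unfolding rel_boundary_def by (smt (verit, best) mem_Collect_eq)
  obtain M where M: "0 < M" "\<And>i j k l. \<bar>Qop R i j k l\<bar> \<le> M"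
    by (rule tensor_bounded[of "Qop R"]) (rule that)
  define N where "N = (real CARD('n))\<^sup>2"
  have N: "0 < N" using n by (simp add: N_def)
  define \<tau> where "\<tau> = \<delta> / (2 * (N * (M + 1)))"
  have \<tau>: "0 < \<tau>" using \<delta>(1) M(1) N by (simp add: \<tau>_def)
  show thesis
  proof (rule that[OF \<tau> zero_less_one], intro allI impI)
    fix V :: "'n tensor4"
    assume V: "alg_curv V" "\<forall>i j k l. \<bar>V i j k l - Qop R i j k l\<bar> \<le> 1"
    have "\<bar>V i j k l\<bar> \<le> M + 1" for i j k l
      using V(2)[rule_format, of i j k l] M(2)[of i j k l] by linarith
    then have "\<bar>(R i j k l + \<tau> * V i j k l) - R i j k l\<bar> \<le> \<tau> * (M + 1)" for i j k l
      using \<tau> by (simp add: abs_mult)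
    then have "tdist (\<lambda>i j k l. R i j k l + \<tau> * V i j k l) R \<le> N * (\<tau> * (M + 1))"
      unfolding N_def by (rule tdist_le)
    also have "\<dots> = \<delta> / 2"
      using M(1) N by (simp add: \<tau>_def)
    also have "\<dots> < \<delta>"
      using \<delta>(1) by simp
    finally show "(\<lambda>i j k l. R i j k l + \<tau> * V i j k l) \<in> C a \<theta>"
      using \<delta>(2) alg_curv_comb[OF aR V(1), of 1 \<tau>] by simp
  qed
next
  case True
  have aR: "alg_curv R" using R(1) unfolding C_def by (rule cone_f_alg_curv)
  obtain X e where e: "0 < e" and aX: "alg_curv X"
    and X: "\<forall>W. alg_curv W \<longrightarrow> (\<forall>i j k l. \<bar>W i j k l\<bar> \<le> e) \<longrightarrow>
       (\<lambda>i j k l. X i j k l + W i j k l) \<in> C a \<theta>"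
    by (rule cone_f_linear_interior[OF n th a, folded C_def]) (rule that)
  have "Qop R \<in> rel_interior_act (tangent_cone (C a \<theta>) R)"
    using tr True R(2) unfolding transversally_invariant_def by blast
  then obtain \<delta> where aQ: "alg_curv (Qop R)" and \<delta>: "0 < \<delta>"
    "\<And>W. alg_curv W \<Longrightarrow> tdist W (Qop R) < \<delta> \<Longrightarrow> W \<in> tangent_cone (C a \<theta>) R"
    unfolding rel_interior_act_def by blast
  obtain M where M: "0 < M" "\<And>i j k l. \<bar>X i j k l - R i j k l\<bar> \<le> M"
    by (rule tensor_bounded[of "\<lambda>i j k l. X i j k l - R i j k l"]) (rule that)
  define N where "N = (real CARD('n))\<^sup>2"
  have N: "0 < N" using n by (simp add: N_def)
  \<comment> \<open>Replacing Q(R) by Q(R) - p (X - R) then costs at most \<delta>/2 in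
    \<open>tdist\<close>.\<close>
  define p where "p = \<delta> / (2 * (N * M))"
  have p: "0 < p" using \<delta>(1) M(1) N by (simp add: p_def)
  define W where "W i j k l = Qop R i j k l - p * (X i j k l - R i j k l)" for i j k l
  have "alg_curv W"
    using alg_curv_comb[OF aQ alg_curv_diff[OF aX aR], of 1 "- p"] by (simp add: W_def[abs_def])
  moreover have "tdist W (Qop R) \<le> N * (p * M)"
    unfolding N_def using M(2) p by (intro tdist_le) (simp add: W_def abs_mult)
  then have "tdist W (Qop R) < \<delta>"
    using \<delta>(1) M(1) N by (simp add: p_def)
  ultimately have "W \<in> tangent_cone (C a \<theta>) R" by (rule \<delta>(2))
  moreover have pe: "0 < p * e / 2" using p e by simp
  ultimately obtain Y c where Y: "Y \<in> C a \<theta>" and c: "0 \<le> c"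
    and YW: "tdist (\<lambda>i j k l. c * (Y i j k l - R i j k l)) W < p * e / 2"
    unfolding tangent_cone_def by blast
  have cp: "0 < c + p" using c p by simp
  show thesis
  \<comment> \<open>The factor c from the tangent cone may be 0; adding p > 0 keeps the step length
    1/(c + p) meaningful. Half of p e is granted to V, the other half to the approximation by
    Y.\<close>
  proof (rule that[of "1 / (c + p)" "p * e / 2"], goal_cases)
    case 3
    show ?case
    proof (intro allI impI)
      fix V :: "'n tensor4"
      assume V: "alg_curv V" "\<forall>i j k l. \<bar>V i j k l - Qop R i j k l\<bar> \<le> p * e / 2"
      \<comment> \<open>Z solves V = c (Y - R) + p (X + Z - R); division by c + p exhibits R + V/(c
        + p) as a convex combination of Y and X + Z.\<close>
      define Z where "Z i j k l = (V i j k l - c * (Y i j k l - R i j k l)) / p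
        - (X i j k l - R i j k l)" for i j k l
      have aY: "alg_curv Y" using Y unfolding C_def by (rule cone_f_alg_curv)
      have aZ: "alg_curv Z"
        using alg_curv_diff[OF alg_curv_comb[OF V(1) alg_curv_diff[OF aY aR], of "1/p" "- c/p"]
            alg_curv_diff[OF aX aR]]
        by (simp add: Z_def[abs_def] diff_divide_distrib)
      moreover have "\<bar>Z i j k l\<bar> \<le> e" for i j k l
      proof -
        have pz: "p * Z i j k l = (V i j k l - Qop R i j k l) - (c * (Y i j k l - R i j k l) - W i j k l)"
          using p by (simp add: Z_def W_def field_simps)
        have "\<bar>c * (Y i j k l - R i j k l) - W i j k l\<bar> \<le> p * e / 2"
          using entry_le_tdist[of "\<lambda>i j k l. c * (Y i j k l - R i j k l)" i j k l W] YW by linarith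
        then have "\<bar>p * Z i j k l\<bar> \<le> p * e"
          unfolding pz using V(2)[rule_format, of i j k l] by linarith
        then show ?thesis using p by (simp add: abs_mult)
      qed
      ultimately have "(\<lambda>i j k l. X i j k l + Z i j k l) \<in> C a \<theta>" by (rule X[rule_format])
      from cone_f_linear_comb[OF Y[unfolded C_def] this[unfolded C_def], of "c / (c + p)" "p / (c + p)"]
      have "(\<lambda>i j k l. c / (c + p) * Y i j k l + p / (c + p) * (X i j k l + Z i j k l)) \<in> C a \<theta>"
        using c p by (simp add: C_def)
      moreover have "c / (c + p) * Y i j k l + p / (c + p) * (X i j k l + Z i j k l)
        = R i j k l + 1 / (c + p) * V i j k l" for i j k l
      proof -
        have "V i j k l = c * (Y i j k l - R i j k l) + p * (X i j k l + Z i j k l - R i j k l)"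
          using p by (simp add: Z_def field_simps)
        then have "c * Y i j k l + p * (X i j k l + Z i j k l) = (c + p) * R i j k l + V i j k l"
          by (simp add: algebra_simps)
        then have "(c * Y i j k l + p * (X i j k l + Z i j k l)) / (c + p) = R i j k l + V i j k l / (c + p)"
          using cp by (simp only: add_divide_distrib) simp
        then show ?thesis by (simp add: add_divide_distrib)
      qed
      ultimately show "(\<lambda>i j k l. R i j k l + 1 / (c + p) * V i j k l) \<in> C a \<theta>" by simp
    qed
  qed (use cp pe in auto)
qed

definition gains :: "real \<Rightarrow> real \<Rightarrow> real \<Rightarrow> ('n::finite) tensor4 \<Rightarrow> bool" where
  "gains a \<eta> \<theta> R \<longleftrightarrow> (\<exists>\<tau>>0. \<exists>\<epsilon>>0. \<exists>K>0. \<forall>V. alg_curv V \<longrightarrow>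
     (\<forall>i j k l. \<bar>V i j k l - Qop R i j k l\<bar> \<le> \<epsilon>) \<longrightarrow>
     (\<exists>S H. decomp \<theta> (\<lambda>i j k l. R i j k l + \<tau> * V i j k l) S H \<and>
        form_le H (a * trf H - \<eta> * K) \<and> trf H \<le> K))"

text \<open>Q is quadratic: under R -> c R directions scale by c^2, step lengths by 1/c and K by c,
  while \<eta> is unchanged.\<close>

lemma gains_scale:
  assumes "gains a \<eta> \<theta> R" "0 < c"
  shows "gains a \<eta> \<theta> (\<lambda>i j k l. c * R i j k l)"
proof -
  obtain \<tau> \<epsilon> K where pos: "0 < \<tau>" "0 < \<epsilon>" "0 < K"
    and *: "\<forall>V. alg_curv V \<longrightarrow> (\<forall>i j k l. \<bar>V i j k l - Qop R i j k l\<bar> \<le> \<epsilon>) \<longrightarrow>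
     (\<exists>S H. decomp \<theta> (\<lambda>i j k l. R i j k l + \<tau> * V i j k l) S H \<and>
        form_le H (a * trf H - \<eta> * K) \<and> trf H \<le> K)"
    using assms(1) unfolding gains_def by (elim exE conjE) (rule that)
  have "\<exists>S H. decomp \<theta> (\<lambda>i j k l. c * R i j k l + \<tau> / c * V i j k l) S H \<and>
        form_le H (a * trf H - \<eta> * (c * K)) \<and> trf H \<le> c * K"
    if V: "alg_curv V" "\<forall>i j k l. \<bar>V i j k l - Qop (\<lambda>i j k l. c * R i j k l) i j k l\<bar> \<le> c\<^sup>2 * \<epsilon>" for V
  proof -
    have "\<bar>V i j k l / c\<^sup>2 - Qop R i j k l\<bar> \<le> \<epsilon>" for i j k l
    proof -
      have "V i j k l / c\<^sup>2 - Qop R i j k l = (V i j k l - c\<^sup>2 * Qop R i j k l) / c\<^sup>2"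
        using assms(2) by (simp add: field_simps)
      then show ?thesis
        using V(2) assms(2) by (simp add: Qop_scale divide_le_eq mult.commute)
    qed
    moreover have "alg_curv (\<lambda>i j k l. V i j k l / c\<^sup>2)"
      using alg_curv_comb[OF V(1) V(1), of "1 / c\<^sup>2" 0] by simp
    ultimately obtain S H where d: "decomp \<theta> (\<lambda>i j k l. R i j k l + \<tau> * (V i j k l / c\<^sup>2)) S H"
      and f: "form_le H (a * trf H - \<eta> * K)" and t: "trf H \<le> K"
      using *[rule_format, of "\<lambda>i j k l. V i j k l / c\<^sup>2"] by blast
    have e: "c * (R i j k l + \<tau> * (V i j k l / c\<^sup>2)) = c * R i j k l + \<tau> / c * V i j k l" for i j k l
      using assms(2) by (simp add: field_simps power2_eq_square)
    have "decomp \<theta> (\<lambda>i j k l. c * R i j k l + \<tau> / c * V i j k l)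
        (\<lambda>i j k l. c * S i j k l) (\<lambda>i j. c * H i j)"
      unfolding e[symmetric] using decomp_comb[OF d d, of c 0] assms(2) by simp
    moreover have "trf (\<lambda>i j. c * H i j) = c * trf H"
      using trf_comb[of c H 0 H] by simp
    moreover have "form_le (\<lambda>i j. c * H i j) (c * (a * trf H - \<eta> * K))"
      using form_le_comb[OF f f, of c 0] assms(2) by simp
    ultimately show ?thesis
      using t assms(2) by (intro exI[of _ "\<lambda>i j k l. c * S i j k l"] exI[of _ "\<lambda>i j. c * H i j"])
        (simp add: algebra_simps)
  qed
  then show ?thesis
    unfolding gains_def using pos assms(2)
    by (intro exI[of _ "\<tau> / c"] exI[of _ "c\<^sup>2 * \<epsilon>"] exI[of _ "c * K"] conjI) auto
qed

lemma gains_antimono: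
  assumes "gains a \<eta> \<theta> R" "\<eta>' \<le> \<eta>"
  shows "gains a \<eta>' \<theta> R"
proof -
  obtain \<tau> \<epsilon> K where pos: "0 < \<tau>" "0 < \<epsilon>" "0 < K"
    and *: "\<forall>V. alg_curv V \<longrightarrow> (\<forall>i j k l. \<bar>V i j k l - Qop R i j k l\<bar> \<le> \<epsilon>) \<longrightarrow>
     (\<exists>S H. decomp \<theta> (\<lambda>i j k l. R i j k l + \<tau> * V i j k l) S H \<and>
        form_le H (a * trf H - \<eta> * K) \<and> trf H \<le> K)"
    using assms(1) unfolding gains_def by (elim exE conjE) (rule that)
  have "form_le H (a * trf H - \<eta>' * K)" if "form_le H (a * trf H - \<eta> * K)" for H :: "'a form2"
    by (rule form_le_mono[OF that]) (use assms(2) pos(3) in simp)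
  with * have "\<forall>V. alg_curv V \<longrightarrow> (\<forall>i j k l. \<bar>V i j k l - Qop R i j k l\<bar> \<le> \<epsilon>) \<longrightarrow>
     (\<exists>S H. decomp \<theta> (\<lambda>i j k l. R i j k l + \<tau> * V i j k l) S H \<and>
        form_le H (a * trf H - \<eta>' * K) \<and> trf H \<le> K)"
    by blast
  with pos show ?thesis unfolding gains_def by blast
qed

lemma tensor_subsequence:
  fixes X :: "nat \<Rightarrow> ('n::finite) tensor4"
  assumes "\<And>m i j k l. \<bar>X m i j k l\<bar> \<le> B"
  obtains r R where "strict_mono (r :: nat \<Rightarrow> nat)" "\<And>i j k l. (\<lambda>m. X (r m) i j k l) \<longlonglongrightarrow> R i j k l"
proof -
  \<comment> \<open>Packing the entries into one Euclidean vector lets Bolzano-Weierstrass treat all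
    of them at once.\<close>
  define Y :: "nat \<Rightarrow> real ^ ('n \<times> 'n \<times> 'n \<times> 'n)" where
    "Y m = (\<chi> p. case p of (i, j, k, l) \<Rightarrow> X m i j k l)" for m
  have "norm (Y m) \<le> (\<Sum>p\<in>(UNIV :: ('n \<times> 'n \<times> 'n \<times> 'n) set). B)" for m
    using assms by (intro order_trans[OF norm_le_l1_cart] sum_mono) (auto simp: Y_def)
  then have "bounded (range Y)" unfolding bounded_iff by blast
  then obtain y r where r: "strict_mono (r :: nat \<Rightarrow> nat)" and y: "(Y \<circ> r) \<longlonglongrightarrow> y"
    using bounded_imp_convergent_subsequence by blast
  have "(\<lambda>m. X (r m) i j k l) \<longlonglongrightarrow> y $ (i, j, k, l)" for i j k l
    using tendsto_vec_nth[OF y, of "(i, j, k, l)"] by (simp add: Y_def)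
  with r show thesis by (rule that)
qed

lemma scal_le:
  fixes R :: "('n::finite) tensor4"
  assumes "\<And>i j k l. \<bar>R i j k l\<bar> \<le> B"
  shows "scal R \<le> (real CARD('n))\<^sup>2 * B"
proof -
  have "scal R \<le> (\<Sum>i\<in>(UNIV::'n set). \<Sum>j\<in>(UNIV::'n set). B)"
    unfolding scal_def ric_def using assms by (intro sum_mono) (simp add: abs_le_iff)
  then show ?thesis by (simp add: power2_eq_square)
qed

text \<open>Part of the freedom in V at R absorbs the move of the base point to X m; another part
  takes out a multiple of the round tensor, which is then put back into H alone. Adding c id raises
  H by c but a tr(H) by a c n, and the surplus c (a n - 1) > 0 outweighs the changes of slope and
  rate for large m.\<close>

lemma gains_at_nearby:
  fixes R :: "('n::finite) tensor4"
  assumes n: "2 < CARD('n)" and th: "0 \<le> \<theta>" and a: "1 < a * real CARD('n)"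
    and tr: "transversally_invariant (cone_f (\<lambda>s. a * s) \<theta> :: 'n tensor4 set)"
    and R: "R \<in> cone_f (\<lambda>s. a * s) \<theta>" "R \<noteq> (\<lambda>i j k l. 0)"
    and X: "\<And>m i j k l. \<bar>X m i j k l\<bar> \<le> 1" "\<And>m. alg_curv (X m)"
    and lim: "\<And>i j k l. (\<lambda>m. X m i j k l) \<longlonglongrightarrow> R i j k l" "\<alpha> \<longlonglongrightarrow> a" "\<eta> \<longlonglongrightarrow> 0"
  shows "\<exists>m. gains (\<alpha> m) (\<eta> m) \<theta> (X m)"
proof -
  obtain \<tau> \<epsilon> where \<tau>: "0 < \<tau>" and \<epsilon>: "0 < \<epsilon>"
    and step: "\<forall>V. alg_curv V \<longrightarrow> (\<forall>i j k l. \<bar>V i j k l - Qop R i j k l\<bar> \<le> \<epsilon>) \<longrightarrow>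
       (\<lambda>i j k l. R i j k l + \<tau> * V i j k l) \<in> cone_f (\<lambda>s. a * s) \<theta>"
    by (rule transversal_step[OF n th a tr R]) (rule that)
  obtain M where M: "0 < M" "\<And>i j k l. \<bar>Qop R i j k l\<bar> \<le> M"
    by (rule tensor_bounded[of "Qop R"]) (rule that)
  define N where "N = real CARD('n)"
  have N: "1 \<le> N" using n by (simp add: N_def)
  \<comment> \<open>The amount of \<open>kn idf idf\<close> taken out during time \<tau> at rate
    \<epsilon>/16; its entries are at most 2 in absolute value, so less than \<epsilon>/4 of the
    tolerance is spent.\<close>
  define c where "c = \<tau> * \<epsilon> / 16"
  have c: "0 < c" using \<tau> \<epsilon> by (simp add: c_def)
  \<comment> \<open>Bounds scal of X m + \<tau> V, whose entries are at most 1 + \<tau> (M +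
    \<epsilon>), and hence the trace of H1.\<close>
  define K where "K = N\<^sup>2 * (1 + \<tau> * (M + \<epsilon>))"
  have K: "0 < K" using N \<tau> M(1) \<epsilon> by (simp add: K_def add_pos_pos)
  have "eventually (\<lambda>m. \<forall>i j k l. dist (X m i j k l) (R i j k l) < \<tau> * \<epsilon> / 4) sequentially"
    using \<tau> \<epsilon> by (intro eventually_all_finite tendstoD lim) simp
  moreover have "eventually (\<lambda>m. \<forall>i j k l. dist (Qop (X m) i j k l) (Qop R i j k l) < \<epsilon> / 4) sequentially"
    using \<epsilon> by (intro eventually_all_finite tendstoD Qop_limit lim) simp
  moreover have "(\<lambda>m. (\<bar>a - \<alpha> m\<bar> + \<eta> m) * K) \<longlonglongrightarrow> (\<bar>a - a\<bar> + 0) * K"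
    by (intro tendsto_intros lim)
  then have "eventually (\<lambda>m. (\<bar>a - \<alpha> m\<bar> + \<eta> m) * K < c * (a * N - 1)) sequentially"
    by (rule order_tendstoD(2)) (use a c in \<open>simp add: N_def\<close>)
  ultimately have "eventually (\<lambda>m. (\<forall>i j k l. dist (X m i j k l) (R i j k l) < \<tau> * \<epsilon> / 4) \<and>
      (\<forall>i j k l. dist (Qop (X m) i j k l) (Qop R i j k l) < \<epsilon> / 4) \<and>
      (\<bar>a - \<alpha> m\<bar> + \<eta> m) * K < c * (a * N - 1)) sequentially"
    by (intro eventually_conj)
  then obtain m where m1: "\<And>i j k l. \<bar>X m i j k l - R i j k l\<bar> < \<tau> * \<epsilon> / 4"
    and m2: "\<And>i j k l. \<bar>Qop (X m) i j k l - Qop R i j k l\<bar> < \<epsilon> / 4"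
    and m3: "(\<bar>a - \<alpha> m\<bar> + \<eta> m) * K < c * (a * N - 1)"
    by (auto simp: dist_real_def dest!: eventually_happens)
  have "\<exists>S H. decomp \<theta> (\<lambda>i j k l. X m i j k l + \<tau> * V i j k l) S H \<and>
        form_le H (\<alpha> m * trf H - \<eta> m * K) \<and> trf H \<le> K"
    if V: "alg_curv V" "\<forall>i j k l. \<bar>V i j k l - Qop (X m) i j k l\<bar> \<le> \<epsilon> / 4" for V
  proof -
    \<comment> \<open>The tolerance \<epsilon> is split into quarters: V against Q(X m), Q(X m)
      against Q(R), the moved base point, and the removed multiple of
      \<open>kn idf idf\<close>.\<close>
    define V' where "V' i j k l = V i j k l + (X m i j k l - R i j k l) / \<tau>
      - \<epsilon> / 16 * kn idf idf i j k l" for i j k l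
    have aid: "alg_curv (kn idf idf :: 'n tensor4)"
      by (rule alg_curv_kn_idf) (simp add: sym_form_def idf_commute)
    have aV': "alg_curv V'"
      using alg_curv_comb[OF alg_curv_comb[OF V(1)
            alg_curv_diff[OF X(2)[of m] cone_f_alg_curv[OF R(1)]], of 1 "1 / \<tau>"] aid, of 1 "- \<epsilon> / 16"]
      by (simp add: V'_def[abs_def])
    have "\<bar>V' i j k l - Qop R i j k l\<bar> \<le> \<epsilon>" for i j k l
    proof -
      have "\<bar>V i j k l - Qop (X m) i j k l\<bar> \<le> \<epsilon> / 4" using V(2) by blast
      moreover have "\<bar>(X m i j k l - R i j k l) / \<tau>\<bar> \<le> \<epsilon> / 4"
        using m1[of i j k l] \<tau> by (simp add: divide_le_eq mult.commute)
      moreover have "\<bar>\<epsilon> / 16 * kn idf idf i j k l\<bar> \<le> \<epsilon> / 4"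
        using \<epsilon> by (simp add: kn_idf_idf idf_def)
      ultimately show ?thesis
        using m2[of i j k l] unfolding V'_def by linarith
    qed
    with aV' have "(\<lambda>i j k l. R i j k l + \<tau> * V' i j k l) \<in> cone_f (\<lambda>s. a * s) \<theta>"
      by (rule step[rule_format])
    then obtain S H where d: "decomp \<theta> (\<lambda>i j k l. R i j k l + \<tau> * V' i j k l) S H"
      and f: "form_le H (a * trf H)"
      unfolding cone_f_iff by blast
    define H1 where "H1 i j = 1 * H i j + c * idf i j" for i j
    have "R i j k l + \<tau> * V' i j k l + c * kn idf idf i j k l = X m i j k l + \<tau> * V i j k l" for i j k l
      using \<tau> by (simp add: V'_def c_def field_simps)
    with decomp_shift[OF d, of c] c
    have d1: "decomp \<theta> (\<lambda>i j k l. X m i j k l + \<tau> * V i j k l) S H1"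
      by (simp add: H1_def[abs_def])
    have tr1: "trf H1 = trf H + c * N"
      unfolding H1_def[abs_def] trf_comb trf_idf N_def by simp
    have tr0: "0 \<le> trf H1"
      by (rule decomp_trf_nonneg[OF d1 th])
    have "\<bar>V i j k l\<bar> \<le> M + \<epsilon>" for i j k l
      using V(2)[rule_format, of i j k l] m2[of i j k l] M(2)[of i j k l] \<epsilon> by linarith
    then have "\<bar>\<tau> * V i j k l\<bar> \<le> \<tau> * (M + \<epsilon>)" for i j k l
      using \<tau> by (simp add: abs_mult)
    then have "\<bar>X m i j k l + \<tau> * V i j k l\<bar> \<le> 1 + \<tau> * (M + \<epsilon>)" for i j k l
      using X(1)[of m i j k l] by (meson abs_triangle_ineq add_mono order_trans)
    then have "scal (\<lambda>i j k l. X m i j k l + \<tau> * V i j k l) \<le> K"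
      unfolding K_def N_def by (rule scal_le)
    moreover have "trf H1 \<le> 2 * (N - 1) * trf H1"
      using n tr0 mult_right_mono[of 1 "2 * (N - 1)" "trf H1"] by (simp add: N_def)
    ultimately have trK: "trf H1 \<le> K"
      using decomp_trf_le[OF d1] unfolding N_def by linarith
    have "form_le H1 (1 * (a * trf H) + c * 1)"
      unfolding H1_def[abs_def] using c by (intro form_le_comb f form_le_idf) auto
    moreover have "1 * (a * trf H) + c * 1 \<le> \<alpha> m * trf H1 - \<eta> m * K"
    proof -
      have "(a - \<alpha> m) * trf H1 \<le> \<bar>a - \<alpha> m\<bar> * K"
        using trK tr0 by (intro mult_mono) auto
      moreover have "a * trf H + c = a * trf H1 - c * (a * N - 1)"
        by (simp add: tr1 algebra_simps)
      ultimately show ?thesis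
        using m3 by (simp add: algebra_simps)
    qed
    ultimately have "form_le H1 (\<alpha> m * trf H1 - \<eta> m * K)"
      by (rule form_le_mono)
    with d1 trK show ?thesis by blast
  qed
  moreover have "0 < \<epsilon> / 4" using \<epsilon> by simp
  ultimately have "gains (\<alpha> m) (\<eta> m) \<theta> (X m)"
    unfolding gains_def using \<tau> K by blast
  then show ?thesis by blast
qed

text \<open>Otherwise there are slopes and nonzero tensors for which the rate 1/(m + 1) fails. By
  scale invariance the tensors may have norm 1, so a limit is nonzero and lies in a cone with slope
  in [a1, a0]; transversality there contradicts the failure for some m.\<close>

lemma gains_locally_uniform:
  fixes a0 a1 \<theta> :: real
  assumes n: "2 < CARD('n::finite)" and th: "0 \<le> \<theta>" and a1: "1 < a1 * real CARD('n)"
    and tr: "\<And>a. a1 \<le> a \<Longrightarrow> a \<le> a0 \<Longrightarrow>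
      transversally_invariant (cone_f (\<lambda>s. a * s) \<theta> :: 'n tensor4 set)"
  shows "\<exists>\<eta>>0. \<forall>a. a1 \<le> a \<and> a \<le> a0 \<longrightarrow>
    (\<forall>R\<in>cone_f (\<lambda>s. a * s) \<theta> :: 'n tensor4 set. R \<noteq> (\<lambda>i j k l. 0) \<longrightarrow> gains a \<eta> \<theta> R)"
proof (rule ccontr)
  assume neg: "\<not> ?thesis"
  then have "\<exists>a R. a1 \<le> a \<and> a \<le> a0 \<and> R \<in> cone_f (\<lambda>s. a * s) \<theta> \<and> (R :: 'n tensor4) \<noteq> (\<lambda>i j k l. 0)
      \<and> \<not> gains a \<eta> \<theta> R" if "0 < \<eta>" for \<eta>
    using that neg by blast
  then have "\<forall>m. \<exists>a R. a1 \<le> a \<and> a \<le> a0 \<and> R \<in> cone_f (\<lambda>s. a * s) \<theta> \<and> (R :: 'n tensor4) \<noteq> (\<lambda>i j k l. 0)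
      \<and> \<not> gains a (inverse (real (Suc m))) \<theta> R"
    by (metis inverse_positive_iff_positive of_nat_0_less_iff zero_less_Suc)
  then obtain \<alpha> Z where \<alpha>: "\<And>m. a1 \<le> \<alpha> m" "\<And>m. \<alpha> m \<le> a0"
    and Z: "\<And>m. (Z m :: 'n tensor4) \<in> cone_f (\<lambda>s. \<alpha> m * s) \<theta>" "\<And>m. Z m \<noteq> (\<lambda>i j k l. 0)"
      "\<And>m. \<not> gains (\<alpha> m) (inverse (real (Suc m))) \<theta> (Z m)"
    by metis
  define \<rho> where "\<rho> m = tdist (Z m) (\<lambda>i j k l. 0)" for m
  have \<rho>: "0 < \<rho> m" for m
  proof -
    obtain i j k l where "Z m i j k l \<noteq> 0" using Z(2)[of m] by (metis ext)
    then show ?thesis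
      using entry_le_tdist[of "Z m" i j k l "\<lambda>i j k l. 0"] by (simp add: \<rho>_def)
  qed
  define X where "X m i j k l = 1 / \<rho> m * Z m i j k l" for m i j k l
  have XC: "X m \<in> cone_f (\<lambda>s. \<alpha> m * s) \<theta>" for m
    using cone_f_linear_comb[OF Z(1)[of m] Z(1)[of m], of "1 / \<rho> m" 0] \<rho>[of m]
    by (simp add: X_def[abs_def])
  have X1: "tdist (X m) (\<lambda>i j k l. 0) = 1" for m
  proof -
    have "tdist (X m) (\<lambda>i j k l. 0) = sqrt ((1 / \<rho> m)\<^sup>2 *
        (\<Sum>i\<in>UNIV. \<Sum>j\<in>UNIV. \<Sum>k\<in>UNIV. \<Sum>l\<in>UNIV. (Z m i j k l - 0)\<^sup>2))"
      unfolding tdist_def X_def sum_distrib_left by (simp add: power_divide)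
    also have "\<dots> = 1 / \<rho> m * \<rho> m"
      unfolding real_sqrt_mult \<rho>_def tdist_def using \<rho>[of m]
      by (simp add: \<rho>_def tdist_def)
    finally show ?thesis using \<rho>[of m] by simp
  qed
  have Xb: "\<bar>X m i j k l\<bar> \<le> 1" for m i j k l
    using entry_le_tdist[of "X m" i j k l "\<lambda>i j k l. 0"] X1[of m] by simp
  have Xg: "\<not> gains (\<alpha> m) (inverse (real (Suc m))) \<theta> (X m)" for m
    using gains_scale[of "\<alpha> m" _ \<theta> "X m" "\<rho> m"] \<rho>[of m] Z(3)[of m] by (auto simp: X_def)
  obtain r R where r: "strict_mono (r :: nat \<Rightarrow> nat)"
    and R: "\<And>i j k l. (\<lambda>m. X (r m) i j k l) \<longlonglongrightarrow> R i j k l"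
    using tensor_subsequence[of X 1] Xb by blast
  obtain p a where p: "strict_mono (p :: nat \<Rightarrow> nat)" and a: "((\<lambda>m. \<alpha> (r m)) \<circ> p) \<longlonglongrightarrow> a" "a1 \<le> a" "a \<le> a0"
    using bounded_real_subsequence[of a1 "\<lambda>m. \<alpha> (r m)" a0] \<alpha> by blast
  define q where "q m = r (p m)" for m
  have q: "strict_mono q" using r p by (simp add: q_def strict_mono_def)
  have \<alpha>q: "(\<lambda>m. \<alpha> (q m)) \<longlonglongrightarrow> a" using a(1) by (simp add: q_def o_def)
  have Rq: "(\<lambda>m. X (q m) i j k l) \<longlonglongrightarrow> R i j k l" for i j k l
    using LIMSEQ_subseq_LIMSEQ[OF R p, of i j k l] by (simp add: q_def o_def)
  have RC: "R \<in> cone_f (\<lambda>s. a * s) \<theta>"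
  proof (rule cone_f_limit[OF n th _ Rq])
    show "X (q m) \<in> cone_f (\<lambda>s. \<alpha> (q m) * s) \<theta>" for m by (rule XC)
    show "(\<lambda>m. \<alpha> (q (s m)) * x m) \<longlonglongrightarrow> a * y" if "strict_mono s" "x \<longlonglongrightarrow> y" for s :: "nat \<Rightarrow> nat" and x y
      using LIMSEQ_subseq_LIMSEQ[OF \<alpha>q that(1)] that(2) by (intro tendsto_mult) (auto simp: o_def)
  qed
  have "(\<lambda>m. tdist (X (q m)) (\<lambda>i j k l. 0)) \<longlonglongrightarrow> tdist R (\<lambda>i j k l. 0)"
    unfolding tdist_def by (intro tendsto_intros Rq)
  then have "tdist R (\<lambda>i j k l. 0) = 1"
    by (simp add: X1 LIMSEQ_const_iff)
  then have R0: "R \<noteq> (\<lambda>i j k l. 0)"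
    by (auto simp: tdist_def)
  have "1 < a * real CARD('n)"
    by (rule less_le_trans[OF a1 mult_right_mono[OF a(2)]]) simp
  moreover have "(\<lambda>m. inverse (real (Suc (q m)))) \<longlonglongrightarrow> 0"
    using LIMSEQ_subseq_LIMSEQ[OF LIMSEQ_inverse_real_of_nat q] by (simp add: o_def)
  ultimately have "\<exists>m. gains (\<alpha> (q m)) (inverse (real (Suc (q m)))) \<theta> (X (q m))"
    by (intro gains_at_nearby[OF n th _ tr[OF a(2,3)] RC R0 Xb cone_f_alg_curv[OF XC] Rq \<alpha>q])
  with Xg show False by blast
qed

section \<open>Invariance\<close>

text \<open>To the right of \<open>trf H0\<close> the function \<open>f\<close> may fall below the line \<open>a * s\<close> at rate \<open>\<eta>\<close>; this loss is
  compensated by the gain, because the pairs \<open>(S, H)\<close> may be interpolated linearly.\<close>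

lemma cone_f_step:
  assumes th: "0 \<le> \<theta>" and d0: "decomp \<theta> R S0 H0" and f0: "form_le H0 (a * trf H0)"
    and g: "gains a \<eta> \<theta> R" and \<eta>: "0 \<le> \<eta>" and \<delta>: "0 < \<delta>"
    and f: "\<And>s. 0 \<le> s \<Longrightarrow> s \<le> trf H0 + \<delta> \<Longrightarrow> a * s - \<eta> * max 0 (s - trf H0) \<le> f s"
  shows "\<exists>\<Lambda>>0. \<exists>\<epsilon>>0. \<forall>V. alg_curv V \<longrightarrow> (\<forall>i j k l. \<bar>V i j k l - Qop R i j k l\<bar> \<le> \<epsilon>) \<longrightarrow>
    (\<forall>x. 0 \<le> x \<and> x \<le> \<Lambda> \<longrightarrow> (\<lambda>i j k l. R i j k l + x * V i j k l) \<in> cone_f f \<theta>)"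
proof -
  obtain \<tau> \<epsilon> K where pos: "0 < \<tau>" "0 < \<epsilon>" "0 < K"
    and *: "\<forall>V. alg_curv V \<longrightarrow> (\<forall>i j k l. \<bar>V i j k l - Qop R i j k l\<bar> \<le> \<epsilon>) \<longrightarrow>
     (\<exists>S H. decomp \<theta> (\<lambda>i j k l. R i j k l + \<tau> * V i j k l) S H \<and>
        form_le H (a * trf H - \<eta> * K) \<and> trf H \<le> K)"
    using g unfolding gains_def by (elim exE conjE) (rule that)
  \<comment> \<open>The 1 keeps the interpolation parameter at most 1; \<delta>/K keeps the growth
    of the trace within \<delta>, the range where \<open>f\<close> is controlled.\<close>
  define \<Lambda> where "\<Lambda> = \<tau> * min 1 (\<delta> / K)"
  have \<Lambda>: "0 < \<Lambda>" using pos \<delta> by (simp add: \<Lambda>_def)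
  have "(\<lambda>i j k l. R i j k l + x * V i j k l) \<in> cone_f f \<theta>"
    if V: "alg_curv V" "\<forall>i j k l. \<bar>V i j k l - Qop R i j k l\<bar> \<le> \<epsilon>" and x: "0 \<le> x" "x \<le> \<Lambda>" for V x
  proof -
    obtain S H where d: "decomp \<theta> (\<lambda>i j k l. R i j k l + \<tau> * V i j k l) S H"
      and fH: "form_le H (a * trf H - \<eta> * K)" and tH: "trf H \<le> K"
      using *[rule_format, of V] V by blast
    define \<mu> where "\<mu> = x / \<tau>"
    have "\<mu> \<le> min 1 (\<delta> / K)"
      using x(2) pos(1) unfolding \<mu>_def \<Lambda>_def by (metis mult.commute pos_divide_le_eq)
    then have \<mu>: "0 \<le> \<mu>" "\<mu> \<le> 1" "\<mu> * K \<le> \<delta>"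
      using x(1) pos by (auto simp: \<mu>_def pos_le_divide_eq)
    define H1 where "H1 i j = (1 - \<mu>) * H0 i j + \<mu> * H i j" for i j
    have tr: "trf H1 = (1 - \<mu>) * trf H0 + \<mu> * trf H"
      unfolding H1_def[abs_def] by (rule trf_comb)
    have e: "(1 - \<mu>) * R i j k l + \<mu> * (R i j k l + \<tau> * V i j k l) = R i j k l + x * V i j k l" for i j k l
      using pos(1) by (simp add: \<mu>_def field_simps)
    have d1: "decomp \<theta> (\<lambda>i j k l. R i j k l + x * V i j k l)
        (\<lambda>i j k l. (1 - \<mu>) * S0 i j k l + \<mu> * S i j k l) H1"
      unfolding e[symmetric] H1_def[abs_def] by (rule decomp_comb[OF d0 d]) (use \<mu> in auto)
    have "form_le H1 ((1 - \<mu>) * (a * trf H0) + \<mu> * (a * trf H - \<eta> * K))"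
      unfolding H1_def[abs_def] by (rule form_le_comb[OF f0 fH]) (use \<mu> in auto)
    moreover have "(1 - \<mu>) * (a * trf H0) + \<mu> * (a * trf H - \<eta> * K) \<le> f (trf H1)"
    proof -
      have h0: "0 \<le> trf H0" by (rule decomp_trf_nonneg[OF d0 th])
      \<comment> \<open>From tr(H) \<le> K and tr(H0) \<ge> 0. The loss is thus at most \<eta> \<mu>
        K, exactly the interpolated gain.\<close>
      have m: "max 0 (trf H1 - trf H0) \<le> \<mu> * K"
      proof -
        have "trf H1 - trf H0 = \<mu> * (trf H - trf H0)" by (simp add: tr algebra_simps)
        also have "\<dots> \<le> \<mu> * K" using \<mu>(1) tH h0 by (intro mult_left_mono) auto
        finally show ?thesis using \<mu>(1) pos(3) by simp
      qed
      have "a * trf H1 - \<eta> * max 0 (trf H1 - trf H0) \<le> f (trf H1)"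
        by (rule f[OF decomp_trf_nonneg[OF d1 th]]) (use m \<mu>(3) in linarith)
      moreover have "\<eta> * max 0 (trf H1 - trf H0) \<le> \<eta> * (\<mu> * K)"
        using m \<eta> by (rule mult_left_mono)
      ultimately show ?thesis by (simp add: tr algebra_simps)
    qed
    ultimately have "form_le H1 (f (trf H1))" by (rule form_le_mono)
    with d1 show ?thesis unfolding cone_f_iff by blast
  qed
  then show ?thesis using \<Lambda> pos(2) by blast
qed

text \<open>Let t0 be the infimum of the times outside F. Closedness puts R(t0) into F. If R(t0) is
  nonzero, \<open>step\<close> applied to the difference quotients keeps the solution in F a little
  longer; if it is 0, the larger invariant cone does so.\<close>

lemma cone_f_invariant:
  fixes f :: "real \<Rightarrow> real" and \<theta> a0 \<delta> :: real
  defines "F \<equiv> cone_f f \<theta> :: ('n::finite) tensor4 set"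
  assumes n: "2 < CARD('n)" and th: "0 \<le> \<theta>" and cont: "continuous_on {0..} f"
    and inv: "ode_invariant (cone_f (\<lambda>s. a0 * s) \<theta> :: 'n tensor4 set)"
    and le: "\<And>s. 0 \<le> s \<Longrightarrow> f s \<le> a0 * s"
    and \<delta>: "0 < \<delta>" and eq: "\<And>s. 0 \<le> s \<Longrightarrow> s \<le> \<delta> \<Longrightarrow> f s = a0 * s"
    and step: "\<And>R. R \<in> F \<Longrightarrow> R \<noteq> (\<lambda>i j k l. 0) \<Longrightarrow>
      \<exists>\<Lambda>>0. \<exists>\<epsilon>>0. \<forall>V. alg_curv V \<longrightarrow> (\<forall>i j k l. \<bar>V i j k l - Qop R i j k l\<bar> \<le> \<epsilon>) \<longrightarrow>
        (\<forall>x. 0 \<le> x \<and> x \<le> \<Lambda> \<longrightarrow> (\<lambda>i j k l. R i j k l + x * V i j k l) \<in> F)"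
  shows "ode_invariant F"
  unfolding ode_invariant_def
proof (intro allI impI, rule ccontr)
  fix T R
  assume sol: "hamilton_solution T R" and R0: "R 0 \<in> F" and "\<not> (\<forall>t\<in>{0..T}. R t \<in> F)"
  define B where "B = {t\<in>{0..T}. R t \<notin> F}"
  define t0 where "t0 = Inf B"
  have Bne: "B \<noteq> {}" using \<open>\<not> _\<close> by (auto simp: B_def)
  have Bbd: "bdd_below B" by (rule bdd_belowI[of _ 0]) (auto simp: B_def)
  have t0: "0 \<le> t0" "t0 \<le> T"
    using Bne cInf_greatest[OF Bne, of 0] cInf_lower[OF _ Bbd] by (fastforce simp: B_def t0_def)+
  have before: "R t \<in> F" if "0 \<le> t" "t < t0" for t
    using that t0 cInf_lower[OF _ Bbd, of t] by (force simp: B_def t0_def)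
  \<comment> \<open>Invariance of the larger cone provides decompositions of R(t) after t0 as well,
    and the curvature symmetries of R(t).\<close>
  have "F \<subseteq> cone_f (\<lambda>s. a0 * s) \<theta>"
    unfolding F_def using le decomp_trf_nonneg[OF _ th] form_le_mono
    by (auto simp: cone_f_iff) blast
  then have RC: "R t \<in> cone_f (\<lambda>s. a0 * s) \<theta>" if "t \<in> {0..T}" for t
    using inv sol R0 that unfolding ode_invariant_def by blast
  have deriv: "((\<lambda>s. R s i j k l) has_real_derivative Qop (R t) i j k l) (at t within {0..T})"
    if "t \<in> {0..T}" for t i j k l
    using sol that unfolding hamilton_solution_def by blast
  then have Rcont: "continuous_on {0..T} (\<lambda>s. R s i j k l)" for i j k l
    by (meson DERIV_continuous continuous_on_eq_continuous_within)
  have Rt0: "R t0 \<in> F"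
  proof (cases "t0 = 0")
    case False
    define u where "u m = t0 * (1 - inverse (real (Suc m)))" for m
    have u: "0 \<le> u m" "u m < t0" for m
      using t0 False by (auto simp: u_def divide_simps)
    have "u \<longlonglongrightarrow> t0 * (1 - 0)"
      unfolding u_def by (intro tendsto_intros LIMSEQ_inverse_real_of_nat)
    then have ul: "u \<longlonglongrightarrow> t0" by simp
    show ?thesis
      unfolding F_def
    proof (rule cone_f_limit[OF n th])
      show "R (u m) \<in> cone_f f \<theta>" for m
        using before[OF u] by (simp add: F_def)
      show "(\<lambda>m. R (u m) i j k l) \<longlonglongrightarrow> R t0 i j k l" for i j k l
        by (rule continuous_on_tendsto_compose[OF Rcont ul])
          (use t0 u less_imp_le[OF u(2)] order_trans[OF less_imp_le[OF u(2)] t0(2)] in auto)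
      show "(\<lambda>m. f (x m)) \<longlonglongrightarrow> f y" if "x \<longlonglongrightarrow> y" "\<And>m. 0 \<le> x m" for x y
        by (rule continuous_on_tendsto_compose[OF cont that(1)])
          (use that LIMSEQ_le_const[OF that(1), of 0] in auto)
    qed
  qed (use R0 in simp)
  have "eventually (\<lambda>t. t0 < t \<longrightarrow> R t \<in> F) (at t0 within {0..T})"
  proof (cases "R t0 = (\<lambda>i j k l. 0)")
    case True
    define N where "N = (real CARD('n))\<^sup>2"
    have N: "0 < N" using n by (simp add: N_def)
    \<comment> \<open>Entries below \<delta>/n^2 give scal \<le> \<delta>, hence tr(H) \<le>
      \<delta> in every decomposition with respect to the larger cone; on [0, \<delta>] the line and
      \<open>f\<close> coincide.\<close>
    have "eventually (\<lambda>t. \<forall>i j k l. dist (R t i j k l) (R t0 i j k l) < \<delta> / N) (at t0 within {0..T})"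
      using t0 \<delta> N Rcont by (intro eventually_all_finite tendstoD) (auto simp: continuous_on_def)
    then show ?thesis
      unfolding eventually_at_filter
    proof (rule eventually_mono, intro impI)
      fix t
      assume *: "t \<noteq> t0 \<longrightarrow> t \<in> {0..T} \<longrightarrow> (\<forall>i j k l. dist (R t i j k l) (R t0 i j k l) < \<delta> / N)"
        and t: "t \<noteq> t0" "t \<in> {0..T}"
      have "\<bar>R t i j k l\<bar> \<le> \<delta> / N" for i j k l
      proof -
        have "dist (R t i j k l) (R t0 i j k l) < \<delta> / N" using * t by blast
        then show ?thesis by (simp add: True)
      qed
      then have "scal (R t) \<le> N * (\<delta> / N)"
        unfolding N_def by (rule scal_le)
      then have sc: "scal (R t) \<le> \<delta>" using N by simp
      obtain S H where d: "decomp \<theta> (R t) S H" and fH: "form_le H (a0 * trf H)"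
        using RC[OF t(2)] unfolding cone_f_iff by blast
      have h0: "0 \<le> trf H" by (rule decomp_trf_nonneg[OF d th])
      have "1 * trf H \<le> 2 * (real CARD('n) - 1) * trf H"
        using h0 n by (intro mult_right_mono) auto
      then have "trf H \<le> \<delta>"
        using decomp_trf_le[OF d] sc by linarith
      with d fH h0 eq show "R t \<in> F"
        unfolding F_def cone_f_iff by metis
    qed
  next
    case False
    obtain \<Lambda> \<epsilon> where \<Lambda>: "0 < \<Lambda>" and \<epsilon>: "0 < \<epsilon>"
      and st: "\<forall>V. alg_curv V \<longrightarrow> (\<forall>i j k l. \<bar>V i j k l - Qop (R t0) i j k l\<bar> \<le> \<epsilon>) \<longrightarrow>
        (\<forall>x. 0 \<le> x \<and> x \<le> \<Lambda> \<longrightarrow> (\<lambda>i j k l. R t0 i j k l + x * V i j k l) \<in> F)"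
      using step[OF Rt0 False] by (elim exE conjE) (rule that)
    have "((\<lambda>t. (R t i j k l - R t0 i j k l) / (t - t0)) \<longlongrightarrow> Qop (R t0) i j k l) (at t0 within {0..T})"
      for i j k l
      using deriv[of t0 i j k l] t0 by (simp add: has_field_derivative_iff)
    then have "eventually (\<lambda>t. \<forall>i j k l.
        dist ((R t i j k l - R t0 i j k l) / (t - t0)) (Qop (R t0) i j k l) < \<epsilon>) (at t0 within {0..T})"
      using \<epsilon> by (intro eventually_all_finite tendstoD)
    moreover have "eventually (\<lambda>t. dist t t0 < \<Lambda>) (at t0 within {0..T})"
      using \<Lambda> by (intro tendstoD tendsto_ident_at)
    ultimately have "eventually (\<lambda>t. (\<forall>i j k l.
        dist ((R t i j k l - R t0 i j k l) / (t - t0)) (Qop (R t0) i j k l) < \<epsilon>) \<and> dist t t0 < \<Lambda>)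
        (at t0 within {0..T})"
      by (rule eventually_conj)
    then show ?thesis
      unfolding eventually_at_filter
    proof (rule eventually_mono, intro impI)
      fix t
      assume *: "t \<noteq> t0 \<longrightarrow> t \<in> {0..T} \<longrightarrow> (\<forall>i j k l.
        dist ((R t i j k l - R t0 i j k l) / (t - t0)) (Qop (R t0) i j k l) < \<epsilon>) \<and> dist t t0 < \<Lambda>"
        and t: "t \<noteq> t0" "t \<in> {0..T}" "t0 < t"
      define V where "V i j k l = (R t i j k l - R t0 i j k l) / (t - t0)" for i j k l
      have ac: "alg_curv (R t)" "alg_curv (R t0)"
        using RC t0 t(2) cone_f_alg_curv by (metis atLeastAtMost_iff)+
      have "alg_curv V"
        using alg_curv_comb[OF ac, of "1 / (t - t0)" "- 1 / (t - t0)"]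
        by (simp add: V_def[abs_def] diff_divide_distrib)
      moreover have "\<forall>i j k l. \<bar>V i j k l - Qop (R t0) i j k l\<bar> \<le> \<epsilon>"
        using * t(1,2) by (auto simp: V_def dist_real_def less_imp_le)
      moreover have "0 \<le> t - t0 \<and> t - t0 \<le> \<Lambda>"
        using * t by (auto simp: dist_real_def)
      ultimately have "(\<lambda>i j k l. R t0 i j k l + (t - t0) * V i j k l) \<in> F"
        using st by blast
      moreover have "(\<lambda>i j k l. R t0 i j k l + (t - t0) * V i j k l) = R t"
        using t(1) by (simp add: V_def fun_eq_iff)
      ultimately show "R t \<in> F" by simp
    qed
  qed
  then obtain e where e: "0 < e" "\<And>t. t \<in> {0..T} \<Longrightarrow> t \<noteq> t0 \<Longrightarrow> dist t t0 < e \<Longrightarrow> t0 < t \<Longrightarrow> R t \<in> F"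
    unfolding eventually_at by blast
  obtain b where b: "b \<in> B" "b < t0 + e"
    using cInf_lessD[OF Bne, of "t0 + e"] e(1) by (auto simp: t0_def)
  have "t0 \<le> b" unfolding t0_def by (rule cInf_lower[OF b(1) Bbd])
  moreover have "b \<noteq> t0" using b(1) Rt0 by (auto simp: B_def)
  ultimately have "R b \<in> F"
    using b by (intro e(2)) (auto simp: B_def dist_real_def)
  with b(1) show False by (simp add: B_def)
qed

section \<open>The pinching function\<close>

text \<open>Each decrement is half of what e permits, capped at half of the current value to keep
  the sequence positive. A limit L > 0 would force all decrements to be at least half of min(L,
  e(L/2)), which convergence forbids.\<close>

lemma slow_decay_sequence:
  fixes e :: "real \<Rightarrow> real" and d0 :: real
  assumes d0: "0 < d0" and e: "\<And>x. 0 < x \<Longrightarrow> 0 < e x"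
    and mono: "\<And>x y. 0 < x \<Longrightarrow> x \<le> y \<Longrightarrow> y \<le> d0 \<Longrightarrow> e x \<le> e y"
  obtains d :: "nat \<Rightarrow> real" where "d 0 = d0" "\<And>i. 0 < d i" "decseq d" "d \<longlonglongrightarrow> 0"
    "\<And>i. d i / 2 \<le> d (Suc i)" "\<And>i. d i - d (Suc i) \<le> e (d i / 2) / 2"
proof -
  define d where "d = rec_nat d0 (\<lambda>_ x. x - min x (e (x / 2)) / 2)"
  have d_0: "d 0 = d0" and d_Suc: "d (Suc i) = d i - min (d i) (e (d i / 2)) / 2" for i
    by (simp_all add: d_def)
  have half: "d i / 2 \<le> d (Suc i)" for i
    unfolding d_Suc by linarith
  have pos: "0 < d i" for i
  proof (induction i)
    case (Suc i)
    then show ?case using half[of i] by linarith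
  qed (simp add: d_0 d0)
  have gap: "0 < min (d i) (e (d i / 2))" for i
    using pos[of i] e[of "d i / 2"] by simp
  have dec: "decseq d"
    unfolding decseq_Suc_iff d_Suc using gap by (simp add: less_imp_le)
  obtain L where L: "d \<longlonglongrightarrow> L" "\<And>i. L \<le> d i"
    using decseq_convergent[OF dec, of 0] pos less_imp_le by metis
  have L0: "0 \<le> L" using LIMSEQ_le_const[OF L(1), of 0] pos less_imp_le by blast
  have "L = 0"
  proof (rule ccontr)
    assume "L \<noteq> 0"
    with L0 have Lp: "0 < L" by simp
    have "(\<lambda>i. 2 * (d i - d (Suc i))) \<longlonglongrightarrow> 2 * (L - L)"
      by (intro tendsto_intros L LIMSEQ_Suc)
    moreover have "min L (e (L / 2)) \<le> 2 * (d i - d (Suc i))" for i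
    proof -
      have "d i \<le> d0" using decseqD[OF dec, of 0 i] d_0 by simp
      then have "e (L / 2) \<le> e (d i / 2)"
        using Lp L(2)[of i] pos[of i] by (intro mono) auto
      then show ?thesis using L(2)[of i] unfolding d_Suc by (simp add: min_le_iff_disj)
    qed
    ultimately have "min L (e (L / 2)) \<le> 2 * (L - L)"
      by (intro LIMSEQ_le_const) auto
    with Lp e[of "L / 2"] show False by simp
  qed
  show thesis
  proof (rule that[OF d_0 pos dec _ half])
    show "d \<longlonglongrightarrow> 0" using L(1) \<open>L = 0\<close> by simp
    show "d i - d (Suc i) \<le> e (d i / 2) / 2" for i unfolding d_Suc by simp
  qed
qed

text \<open>The function is the lower envelope of the lines \<open>d i * s + b i\<close>; consecutive lines cross at
  \<open>p (Suc i)\<close>. Placing the crossing points far apart keeps \<open>\<phi> s / s - \<phi>' s = b i / s\<close> below the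
  threshold that \<open>P\<close> prescribes at the slope \<open>\<phi> s / s\<close>.\<close>

lemma slowly_bending_function:
  fixes d0 :: real and P :: "real \<Rightarrow> real \<Rightarrow> bool"
  assumes d0: "0 < d0"
    and P: "\<And>d. 0 < d \<Longrightarrow> d \<le> d0 \<Longrightarrow> \<exists>\<eta>>0. \<forall>x. d \<le> x \<and> x \<le> d0 \<longrightarrow> P x \<eta>"
    and anti: "\<And>x \<eta> \<eta>'. P x \<eta> \<Longrightarrow> 0 < \<eta>' \<Longrightarrow> \<eta>' \<le> \<eta> \<Longrightarrow> P x \<eta>'"
  obtains \<phi> :: "real \<Rightarrow> real" where "concave_on {0..} \<phi>" "continuous_on {0..} \<phi>" "mono_on {0..} \<phi>"
    "\<forall>s\<ge>0. 0 \<le> \<phi> s" "\<forall>s\<ge>0. \<phi> s \<le> d0 * s" "\<forall>s\<in>{0..1}. \<phi> s = d0 * s"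
    "((\<lambda>s. \<phi> s / s) \<longlongrightarrow> 0) at_top"
    "\<forall>s0\<ge>0. \<exists>x \<eta> \<delta>. 0 < x \<and> x \<le> d0 \<and> 0 < \<eta> \<and> P x \<eta> \<and> 0 < \<delta> \<and> \<phi> s0 = x * s0 \<and>
       (\<forall>s. 0 \<le> s \<and> s \<le> s0 + \<delta> \<longrightarrow> x * s - \<eta> * max 0 (s - s0) \<le> \<phi> s)"
proof -
  \<comment> \<open>The rates granted by P need not depend monotonically on d, but the sets
    \<open>E d\<close> grow with d and so do their suprema. The bound 1 keeps these finite, and half
    of a supremum is still an admissible rate.\<close>
  define E where "E d = {\<eta>. 0 < \<eta> \<and> \<eta> \<le> 1 \<and> (\<forall>x. d \<le> x \<and> x \<le> d0 \<longrightarrow> P x \<eta>)}" for d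
  define e where "e d = Sup (E d) / 2" for d
  have bdd: "bdd_above (E d)" for d by (rule bdd_aboveI[of _ 1]) (simp add: E_def)
  have Ene: "\<exists>\<eta>. \<eta> \<in> E d" if d: "0 < d" for d
  proof -
    obtain \<eta> where \<eta>: "0 < \<eta>" "\<forall>x. min d d0 \<le> x \<and> x \<le> d0 \<longrightarrow> P x \<eta>"
      using P[of "min d d0"] d d0 by auto
    then have "\<forall>x. d \<le> x \<and> x \<le> d0 \<longrightarrow> P x (min \<eta> 1)"
      using anti[of _ \<eta> "min \<eta> 1"] by auto
    with \<eta>(1) show ?thesis by (intro exI[of _ "min \<eta> 1"]) (simp add: E_def)
  qed
  have epos: "0 < e d" if d: "0 < d" for d
  proof -
    obtain \<eta> where \<eta>: "\<eta> \<in> E d" using Ene[OF d] by blast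
    then have "\<eta> \<le> Sup (E d)" using bdd by (rule cSup_upper)
    with \<eta> show ?thesis by (simp add: e_def E_def)
  qed
  have eP: "P x (e d)" if "0 < d" "d \<le> x" "x \<le> d0" for x d
  proof -
    have "E d \<noteq> {}" using Ene[OF that(1)] by blast
    moreover have "e d < Sup (E d)" using epos[OF that(1)] by (simp add: e_def)
    ultimately obtain \<eta> where "\<eta> \<in> E d" "e d < \<eta>" using less_cSupD by metis
    then show ?thesis using anti[of x \<eta> "e d"] epos[OF that(1)] that by (simp add: E_def)
  qed
  have emono: "e x \<le> e y" if "0 < x" "x \<le> y" for x y
  proof -
    have "Sup (E x) \<le> Sup (E y)"
      using Ene[OF that(1)] that(2) bdd by (intro cSup_subset_mono) (auto simp: E_def)
    then show ?thesis by (simp add: e_def)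
  qed
  obtain d :: "nat \<Rightarrow> real" where d_0: "d 0 = d0" and dpos: "\<And>i. 0 < d i" and dec: "decseq d"
    and dlim: "d \<longlonglongrightarrow> 0" and dhalf: "\<And>i. d i / 2 \<le> d (Suc i)"
    and dgap: "\<And>i. d i - d (Suc i) \<le> e (d i / 2) / 2"
    using slow_decay_sequence[OF d0, of e] epos emono by metis
  \<comment> \<open>The spacing 1 makes p unbounded; the term 2 b / e makes the old intercept at
    most half of e p; the new intercept is the one for which lines i and i + 1 meet at
    \<open>p (Suc i)\<close>.\<close>
  define pb where "pb = rec_nat (0::real, 0::real) (\<lambda>i (p, b).
     (max (p + 1) (2 * b / e (d i / 2)), b + (d i - d (Suc i)) * max (p + 1) (2 * b / e (d i / 2))))"
  define p where "p i = fst (pb i)" for i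
  define b where "b i = snd (pb i)" for i
  have p_0: "p 0 = 0" and b_0: "b 0 = 0"
    by (simp_all add: p_def b_def pb_def)
  have p_Suc: "p (Suc i) = max (p i + 1) (2 * b i / e (d i / 2))" for i
    by (simp add: p_def b_def pb_def split_beta)
  have b_Suc: "b (Suc i) = b i + (d i - d (Suc i)) * p (Suc i)" for i
    by (simp add: p_def b_def pb_def split_beta)
  have pstep: "p i + 1 \<le> p (Suc i)" for i unfolding p_Suc by simp
  have pmono: "p i \<le> p j" if "i \<le> j" for i j
    by (rule lift_Suc_mono_le[OF _ that]) (use pstep in \<open>smt (verit)\<close>)
  have p_ge: "real i \<le> p i" for i
  proof (induction i)
    case (Suc i)
    then show ?case using pstep[of i] by simp
  qed (simp add: p_0)
  have dmono: "d j \<le> d i" if "i \<le> j" for i j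
    using dec that by (rule decseqD)
  have bpos: "0 \<le> b i" for i
  proof (induction i)
    case (Suc i)
    have "0 \<le> (d i - d (Suc i)) * p (Suc i)"
      using dmono[of i "Suc i"] p_ge[of "Suc i"] by (intro mult_nonneg_nonneg) auto
    with Suc show ?case by (simp add: b_Suc)
  qed (simp add: b_0)
  \<comment> \<open>The old intercept and its increment each use half of the permitted rate.\<close>
  have b_le: "b (Suc i) \<le> e (d i / 2) * p (Suc i)" for i
  proof -
    have e': "0 < e (d i / 2)" using epos dpos[of i] by simp
    have "2 * b i / e (d i / 2) \<le> p (Suc i)" unfolding p_Suc by simp
    then have "b i \<le> e (d i / 2) / 2 * p (Suc i)"
      using e' by (simp add: pos_divide_le_eq mult.commute)
    moreover have "(d i - d (Suc i)) * p (Suc i) \<le> e (d i / 2) / 2 * p (Suc i)"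
      using dgap[of i] p_ge[of "Suc i"] by (intro mult_right_mono) auto
    ultimately show ?thesis unfolding b_Suc by linarith
  qed
  define l where "l i s = d i * s + b i" for i s
  define \<phi> where "\<phi> s = (INF i. l i s)" for s
  \<comment> \<open>The sign of \<open>p (Suc i) - s\<close> orders consecutive lines; as p
    increases, line i is the lowest between \<open>p i\<close> and \<open>p (Suc i)\<close>.\<close>
  have l_step: "l (Suc i) s - l i s = (d i - d (Suc i)) * (p (Suc i) - s)" for i s
    by (simp add: l_def b_Suc algebra_simps)
  have l_up: "l i s \<le> l (i + k) s" if "s \<le> p (Suc i)" for i k s
  proof (induction k)
    case (Suc k)
    have "0 \<le> (d (i + k) - d (Suc (i + k))) * (p (Suc (i + k)) - s)"
      using dmono[of "i + k" "Suc (i + k)"] pmono[of "Suc i" "Suc (i + k)"] that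
      by (intro mult_nonneg_nonneg) auto
    with Suc l_step[of "i + k" s] show ?case by simp
  qed simp
  have l_down: "l (j + k) s \<le> l j s" if "p (j + k) \<le> s" for j k s
    using that
  proof (induction k)
    case (Suc k)
    have "0 \<le> (d (j + k) - d (Suc (j + k))) * (s - p (Suc (j + k)))"
      using dmono[of "j + k" "Suc (j + k)"] Suc.prems by (intro mult_nonneg_nonneg) auto
    moreover have "p (j + k) \<le> s" using Suc.prems pmono[of "j + k" "j + Suc k"] by simp
    ultimately show ?case using Suc.IH l_step[of "j + k" s] by (simp add: algebra_simps)
  qed simp
  have \<phi>_eq: "\<phi> s = l i s" if "p i \<le> s" "s \<le> p (Suc i)" for i s
    unfolding \<phi>_def
  proof (rule cInf_eq_minimum)
    fix y
    assume "y \<in> range (\<lambda>i. l i s)"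
    then obtain j where y: "y = l j s" by blast
    show "l i s \<le> y"
    proof (cases "i \<le> j")
      case True
      then show ?thesis using l_up[OF that(2), of "j - i"] y by simp
    next
      case False
      then show ?thesis using l_down[of j "i - j" s] that(1) y by simp
    qed
  qed simp
  have piece: "\<exists>i. p i \<le> s \<and> s < p (Suc i)" if "0 \<le> s" for s
  proof -
    obtain m where "s < real m" using reals_Archimedean2 by blast
    then have ex: "\<exists>i. s < p i" using p_ge[of m] by (intro exI[of _ m]) linarith
    define k where "k = (LEAST i. s < p i)"
    have k: "s < p k" unfolding k_def using ex by (rule LeastI_ex)
    have "k \<noteq> 0" using k that p_0 by (metis not_le)
    then obtain i where i: "k = Suc i" using not0_implies_Suc by blast
    then have "\<not> s < p i" using not_less_Least[of i "\<lambda>i. s < p i"] k_def by simp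
    with k i show ?thesis by (intro exI[of _ i]) simp
  qed
  have \<phi>_ex: "\<exists>i. \<phi> s = l i s" if "0 \<le> s" for s
    using piece[OF that] \<phi>_eq less_imp_le by blast
  have \<phi>_le: "\<phi> s \<le> l i s" if "0 \<le> s" for s i
  proof -
    have "bdd_below (range (\<lambda>i. l i s))"
      by (rule bdd_belowI2[of _ 0]) (use dpos bpos that in \<open>auto simp: l_def less_imp_le\<close>)
    then show ?thesis unfolding \<phi>_def by (rule cINF_lower) simp
  qed
  have \<phi>_nonneg: "0 \<le> \<phi> s" if s: "0 \<le> s" for s
  proof -
    obtain i where "\<phi> s = l i s" using \<phi>_ex[OF s] by blast
    then show ?thesis using dpos[of i] bpos[of i] s by (simp add: l_def)
  qed
  have \<phi>_le0: "\<phi> s \<le> d0 * s" if "0 \<le> s" for s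
    using \<phi>_le[OF that, of 0] by (simp add: l_def d_0 b_0)
  have \<phi>_lin: "\<phi> s = d0 * s" if "0 \<le> s" "s \<le> p 1" for s
    using \<phi>_eq[of 0 s] that by (simp add: l_def d_0 b_0 p_0)
  have p1: "1 \<le> p 1" using p_ge[of 1] by simp
  have \<phi>_diff: "\<phi> x \<le> \<phi> y \<and> \<phi> y \<le> \<phi> x + d0 * (y - x)" if x: "0 \<le> x" "x \<le> y" for x y
  proof
    have y: "0 \<le> y" using x by simp
    obtain i where i: "\<phi> y = l i y" using \<phi>_ex[OF y] by blast
    have "\<phi> x \<le> l i x" by (rule \<phi>_le[OF x(1)])
    also have "\<dots> \<le> l i y" using x dpos[of i] by (simp add: l_def)
    finally show "\<phi> x \<le> \<phi> y" using i by simp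
    obtain j where j: "\<phi> x = l j x" using \<phi>_ex[OF x(1)] by blast
    have "d j * (y - x) \<le> d0 * (y - x)"
      using x dmono[of 0 j] d_0 by (intro mult_right_mono) auto
    moreover have "\<phi> y \<le> l j y" by (rule \<phi>_le[OF y])
    ultimately show "\<phi> y \<le> \<phi> x + d0 * (y - x)"
      using j by (simp add: l_def algebra_simps)
  qed
  have conc: "concave_on {0..} \<phi>"
    unfolding concave_on_iff
  proof (intro conjI ballI allI impI)
    fix x y u v :: real
    assume *: "x \<in> {0..}" "y \<in> {0..}" "0 \<le> u" "0 \<le> v" "u + v = 1"
    obtain i where i: "\<phi> (u * x + v * y) = l i (u * x + v * y)"
      using \<phi>_ex[of "u * x + v * y"] * by auto
    have "u * \<phi> x + v * \<phi> y \<le> u * l i x + v * l i y"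
      using * \<phi>_le by (intro add_mono mult_left_mono) auto
    also have "\<dots> = l i (u * x + v * y)"
    proof -
      have "b i = (u + v) * b i" using * by simp
      then show ?thesis unfolding l_def by (simp add: algebra_simps)
    qed
    finally show "u * \<phi> x + v * \<phi> y \<le> \<phi> (u *\<^sub>R x + v *\<^sub>R y)" using i by simp
  qed simp
  have cont: "continuous_on {0..} \<phi>"
  proof (rule lipschitz_on_continuous_on)
    show "d0-lipschitz_on {0..} \<phi>"
    proof (rule lipschitz_onI)
      fix x y :: real assume "x \<in> {0..}" "y \<in> {0..}"
      then show "dist (\<phi> x) (\<phi> y) \<le> d0 * dist x y"
        using \<phi>_diff[of x y] \<phi>_diff[of y x] by (cases "x \<le> y") (auto simp: dist_real_def abs_real_def)
    qed (use d0 in simp)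
  qed
  have lim: "((\<lambda>s. \<phi> s / s) \<longlongrightarrow> 0) at_top"
  proof (rule tendstoI)
    fix \<epsilon> :: real assume \<epsilon>: "0 < \<epsilon>"
    have "eventually (\<lambda>i. d i < \<epsilon> / 2) sequentially"
      using dlim \<epsilon> by (intro order_tendstoD(2)[OF dlim]) simp
    then obtain i where i: "d i < \<epsilon> / 2" by (auto dest: eventually_happens)
    show "eventually (\<lambda>s. dist (\<phi> s / s) 0 < \<epsilon>) at_top"
      using eventually_ge_at_top[of "2 * b i / \<epsilon> + 1"]
    proof eventually_elim
      case (elim s)
      have "0 \<le> 2 * b i / \<epsilon>" using bpos \<epsilon> by simp
      then have s: "0 < s" using elim by linarith
      have "2 * b i / \<epsilon> \<le> s" using elim by linarith
      then have "b i \<le> \<epsilon> / 2 * s" using \<epsilon> by (simp add: pos_divide_le_eq mult.commute)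
      moreover have "d i * s < \<epsilon> / 2 * s" using i s by (rule mult_strict_right_mono)
      ultimately have "\<phi> s < \<epsilon> * s" using \<phi>_le[OF less_imp_le[OF s], of i] unfolding l_def by linarith
      then show ?case using \<phi>_nonneg[of s] s by (simp add: pos_divide_less_eq)
    qed
  qed
  have loc: "\<exists>x \<eta> \<delta>. 0 < x \<and> x \<le> d0 \<and> 0 < \<eta> \<and> P x \<eta> \<and> 0 < \<delta> \<and> \<phi> s0 = x * s0 \<and>
       (\<forall>s. 0 \<le> s \<and> s \<le> s0 + \<delta> \<longrightarrow> x * s - \<eta> * max 0 (s - s0) \<le> \<phi> s)" if s0: "0 \<le> s0" for s0
  proof -
    obtain i where i: "p i \<le> s0" "s0 < p (Suc i)" using piece[OF s0] by blast
    show ?thesis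
    proof (cases i)
      case 0
      have "d0 * s - e d0 * max 0 (s - s0) \<le> \<phi> s" if "0 \<le> s" "s \<le> s0 + (p 1 - s0)" for s
      proof -
        have "0 \<le> e d0 * max 0 (s - s0)" using epos[OF d0] by simp
        then show ?thesis using \<phi>_lin[of s] that by simp
      qed
      moreover have "P d0 (e d0)" using eP d0 by simp
      moreover have "\<phi> s0 = d0 * s0" using \<phi>_lin[OF s0] i 0 by simp
      moreover have "0 < p 1 - s0" using i 0 by simp
      ultimately show ?thesis using d0 epos[OF d0] by blast
    next
      case (Suc k)
      have "1 \<le> s0" using i(1) p_ge[of i] Suc by simp
      then have s0p: "0 < s0" by simp
      define x where "x = \<phi> s0 / s0"
      \<comment> \<open>With i = k + 1, the argument \<open>d k / 2\<close> is a lower bound for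
        \<open>d i\<close>, and so for the chord slope x.\<close>
      define \<eta> where "\<eta> = e (d k / 2)"
      have \<phi>0: "\<phi> s0 = d i * s0 + b i" using \<phi>_eq[of i s0] i by (simp add: l_def)
      have xs: "\<phi> s0 = x * s0" using s0p by (simp add: x_def)
      have x_eq: "x = d i + b i / s0" using s0p by (simp add: x_def \<phi>0 field_simps)
      have "0 \<le> b i / s0" using bpos[of i] s0p by simp
      then have x_ge: "d i \<le> x" using x_eq by simp
      have x_le: "x \<le> d0" using \<phi>_le0[OF s0] s0p by (simp add: x_def pos_divide_le_eq)
      have \<eta>pos: "0 < \<eta>" using epos dpos[of k] by (simp add: \<eta>_def)
      have "P x \<eta>"
        unfolding \<eta>_def by (rule eP) (use dpos[of k] dhalf[of k] x_ge x_le Suc in auto)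
      moreover have "x * s - \<eta> * max 0 (s - s0) \<le> \<phi> s" if s: "0 \<le> s" "s \<le> s0 + (p (Suc i) - s0)" for s
      proof (cases "s \<le> s0")
        \<comment> \<open>Left of s0 the chord from the origin stays below every line of the
          envelope, since their intercepts are nonnegative.\<close>
        case True
        obtain j where j: "\<phi> s = l j s" using \<phi>_ex[OF s(1)] by blast
        have "x * s = s / s0 * \<phi> s0" using s0p by (simp add: x_def)
        also have "\<dots> \<le> s / s0 * l j s0"
          using \<phi>_le[OF s0, of j] s(1) s0p by (intro mult_left_mono) auto
        also have "\<dots> = d j * s + s / s0 * b j"
          using s0p by (simp add: l_def field_simps)
        also have "\<dots> \<le> d j * s + 1 * b j"
          using True s0p bpos[of j] by (intro add_left_mono mult_right_mono) auto
        finally show ?thesis using True j by (simp add: l_def)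
      next
        \<comment> \<open>Right of s0 the chord leaves the current piece at rate b i / s0, which the
          position of the crossing points keeps below or equal to \<eta>.\<close>
        case False
        have "b i \<le> \<eta> * p i" using b_le[of k] Suc by (simp add: \<eta>_def)
        also have "\<dots> \<le> \<eta> * s0" using i(1) \<eta>pos by simp
        finally have "b i / s0 \<le> \<eta>" using s0p by (simp add: pos_divide_le_eq)
        then have "b i / s0 * (s - s0) \<le> \<eta> * (s - s0)"
          using False by (intro mult_right_mono) auto
        moreover have "\<phi> s = d i * s + b i" using \<phi>_eq[of i s] i s False by (simp add: l_def)
        moreover have "x * s = d i * s + b i + b i / s0 * (s - s0)"
          using s0p by (simp add: x_eq field_simps)
        ultimately show ?thesis using False by simp
      qed
      moreover have "0 < p (Suc i) - s0" using i by simp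
      moreover have "0 < x" using x_ge dpos[of i] by simp
      ultimately show ?thesis using x_le xs \<eta>pos by blast
    qed
  qed
  show thesis
  proof (rule that[OF conc cont _ _ _ _ lim])
    show "mono_on {0..} \<phi>" using \<phi>_diff by (simp add: mono_on_def)
    show "\<forall>s\<ge>0. 0 \<le> \<phi> s" using \<phi>_nonneg by blast
    show "\<forall>s\<ge>0. \<phi> s \<le> d0 * s" using \<phi>_le0 by blast
    show "\<forall>s\<in>{0..1}. \<phi> s = d0 * s" using \<phi>_lin p1 by simp
  qed (intro allI impI loc)
qed

theorem theorem2p7:
  fixes \<sigma>0 \<theta> thetabar :: real
  assumes "CARD('n::finite) \<ge> 5"
    and "1 < \<sigma>0" "\<sigma>0 < 2"
    and "admissible_thetabar TYPE('n) thetabar"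
    and "0 < \<theta>" "\<theta> < thetabar"
  shows "\<exists>f :: real \<Rightarrow> real.
           concave_on {0..} f \<and> strict_mono_on {0..} f \<and> (\<forall>s\<ge>0. 0 \<le> f s) \<and>
           (\<exists>\<delta>>0. \<forall>s. 0 \<le> s \<and> s \<le> \<delta> \<longrightarrow> f s = s / (real CARD('n) - 2 * \<sigma>0)) \<and>
           ((\<lambda>s. f s / s) \<longlongrightarrow> 1 / (real CARD('n) - 2)) at_top \<and>
           ode_invariant (cone_f f \<theta> :: 'n tensor4 set)"
proof -
  define n where "n = real CARD('n)"
  have n5: "5 \<le> n" and n2: "2 < CARD('n)" using assms(1) by (simp_all add: n_def)
  have th: "0 \<le> \<theta>" using assms(5) by simp
  \<comment> \<open>The limit slope belongs to \<sigma> = 1. Only the excess x = a - c, ranging over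
    (0, a0 - c], is handed to the bending construction.\<close>
  define c where "c = 1 / (n - 2)"
  define a0 where "a0 = 1 / (n - 2 * \<sigma>0)"
  have c0: "0 < c" using n5 by (simp add: c_def)
  have cn: "1 < c * n" using n5 by (simp add: c_def field_simps)
  have ca: "c < a0" unfolding c_def a0_def using n5 assms(2,3) by (intro divide_strict_left_mono) auto
  have inv: "ode_invariant (cone_f (\<lambda>s. a0 * s) \<theta> :: 'n tensor4 set)"
  proof -
    have "ode_invariant (cone_C \<sigma>0 \<theta> :: 'n tensor4 set)"
      using assms unfolding admissible_thetabar_def by simp
    then show ?thesis
      using n5 assms(3) by (simp add: cone_C_eq_cone_f n_def a0_def)
  qed
  have tr: "transversally_invariant (cone_f (\<lambda>s. a * s) \<theta> :: 'n tensor4 set)"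
    if a: "c < a" "a \<le> a0" for a
  proof -
    \<comment> \<open>Solves a = 1/(n - 2 \<sigma>). Slopes in (c, a0] correspond to \<sigma> in (1,
      \<sigma>0], and \<sigma>0 < 2 allows the endpoint a0.\<close>
    define \<sigma> where "\<sigma> = (n - 1 / a) / 2"
    have a_pos: "0 < a" using a c0 by simp
    have "1 / a < n - 2" using a(1) a_pos n5 by (simp add: c_def field_simps)
    moreover have "n - 2 * \<sigma>0 \<le> 1 / a"
      using a(2) a_pos n5 assms(3) by (simp add: a0_def field_simps)
    ultimately have \<sigma>: "1 < \<sigma>" "\<sigma> < 2" using assms(3) by (auto simp: \<sigma>_def)
    have "transversally_invariant (cone_C \<sigma> \<theta> :: 'n tensor4 set)"
      using assms \<sigma> unfolding admissible_thetabar_def by simp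
    moreover have "2 * \<sigma> = n - 1 / a" by (simp add: \<sigma>_def)
    then have "1 / (n - 2 * \<sigma>) = a" by simp
    ultimately show ?thesis
      using n5 \<sigma>(2) by (simp add: cone_C_eq_cone_f n_def)
  qed
  define P where "P x \<eta> \<longleftrightarrow> (\<forall>R\<in>cone_f (\<lambda>s. (c + x) * s) \<theta> :: 'n tensor4 set.
    R \<noteq> (\<lambda>i j k l. 0) \<longrightarrow> gains (c + x) \<eta> \<theta> R)" for x \<eta>
  have P_ex: "\<exists>\<eta>>0. \<forall>x. d \<le> x \<and> x \<le> a0 - c \<longrightarrow> P x \<eta>" if d: "0 < d" for d
  proof -
    have "c * n \<le> (c + d) * n" using d n5 by (intro mult_right_mono) auto
    then have cd: "1 < (c + d) * real CARD('n)" using cn unfolding n_def by linarith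
    have "\<exists>\<eta>>0. \<forall>a. c + d \<le> a \<and> a \<le> a0 \<longrightarrow>
      (\<forall>R\<in>cone_f (\<lambda>s. a * s) \<theta> :: 'n tensor4 set. R \<noteq> (\<lambda>i j k l. 0) \<longrightarrow> gains a \<eta> \<theta> R)"
      by (rule gains_locally_uniform[OF n2 th cd]) (use tr d in auto)
    then show ?thesis unfolding P_def by (metis add.commute add_le_cancel_left le_diff_eq)
  qed
  have P_anti: "P x \<eta>'" if "P x \<eta>" "\<eta>' \<le> \<eta>" for x \<eta> \<eta>'
    using that gains_antimono unfolding P_def by blast
  have d0: "0 < a0 - c" using ca by simp
  obtain \<phi> where conc: "concave_on {0..} \<phi>" and cont: "continuous_on {0..} \<phi>" and mono: "mono_on {0..} \<phi>"
    and nonneg: "\<forall>s\<ge>0. 0 \<le> \<phi> s" and le: "\<forall>s\<ge>0. \<phi> s \<le> (a0 - c) * s"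
    and lin: "\<forall>s\<in>{0..1}. \<phi> s = (a0 - c) * s"
    and lim: "((\<lambda>s. \<phi> s / s) \<longlongrightarrow> 0) at_top"
    and loc: "\<forall>s0\<ge>0. \<exists>x \<eta> \<delta>. 0 < x \<and> x \<le> a0 - c \<and> 0 < \<eta> \<and> P x \<eta> \<and> 0 < \<delta> \<and>
       \<phi> s0 = x * s0 \<and> (\<forall>s. 0 \<le> s \<and> s \<le> s0 + \<delta> \<longrightarrow> x * s - \<eta> * max 0 (s - s0) \<le> \<phi> s)"
    by (rule slowly_bending_function[OF d0, of P])
      (rule P_ex, assumption, rule P_anti, assumption, assumption, rule that)
  \<comment> \<open>The linear part supplies strict monotonicity and the limit slope; \<phi> carries
    the decaying excess.\<close>
  define f where "f s = c * s + \<phi> s" for s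
  have "concave_on {0..} f"
    unfolding concave_on_iff
  proof (intro conjI ballI allI impI)
    fix x y u v :: real
    assume "x \<in> {0..}" "y \<in> {0..}" "0 \<le> u" "0 \<le> v" "u + v = 1"
    then have "u * \<phi> x + v * \<phi> y \<le> \<phi> (u *\<^sub>R x + v *\<^sub>R y)"
      using conc unfolding concave_on_iff by blast
    then show "u * f x + v * f y \<le> f (u *\<^sub>R x + v *\<^sub>R y)"
      by (simp add: f_def algebra_simps)
  qed simp
  moreover have "strict_mono_on {0..} f"
    using mono c0 by (auto simp: strict_mono_on_def mono_on_def f_def intro!: add_less_le_mono)
  moreover have "\<forall>s\<ge>0. 0 \<le> f s"
    using nonneg c0 by (simp add: f_def)
  moreover have lin': "f s = a0 * s" if "0 \<le> s" "s \<le> 1" for s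
    using lin[rule_format, of s] that by (simp add: f_def algebra_simps)
  then have "\<exists>\<delta>>0. \<forall>s. 0 \<le> s \<and> s \<le> \<delta> \<longrightarrow> f s = s / (real CARD('n) - 2 * \<sigma>0)"
    by (intro exI[of _ 1]) (simp add: a0_def n_def)
  moreover have "((\<lambda>s. f s / s) \<longlongrightarrow> 1 / (real CARD('n) - 2)) at_top"
  proof -
    have "((\<lambda>s. c + \<phi> s / s) \<longlongrightarrow> c + 0) at_top"
      by (intro tendsto_intros lim)
    moreover have "eventually (\<lambda>s. c + \<phi> s / s = f s / s) at_top"
      using eventually_gt_at_top[of 0] by eventually_elim (simp add: f_def add_divide_distrib)
    ultimately show ?thesis
      using tendsto_cong by (force simp: c_def n_def)
  qed
  moreover have "ode_invariant (cone_f f \<theta> :: 'n tensor4 set)"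
  proof (rule cone_f_invariant[OF n2 th _ inv _ zero_less_one lin'])
    show "continuous_on {0..} f"
      unfolding f_def by (intro continuous_intros cont)
    show "f s \<le> a0 * s" if "0 \<le> s" for s
      using le[rule_format, OF that] by (simp add: f_def algebra_simps)
    fix R :: "'n tensor4"
    assume R: "R \<in> cone_f f \<theta>" "R \<noteq> (\<lambda>i j k l. 0)"
    obtain S0 H0 where d: "decomp \<theta> R S0 H0" and fH: "form_le H0 (f (trf H0))"
      using R(1) unfolding cone_f_iff by blast
    \<comment> \<open>The slope c + x satisfies (c + x) tr(H0) = f(tr(H0)), so R lies in that cone
      by means of the same pair.\<close>
    obtain x \<eta> \<delta> where x: "0 < \<eta>" "P x \<eta>" "0 < \<delta>" "\<phi> (trf H0) = x * trf H0"
      "\<forall>s. 0 \<le> s \<and> s \<le> trf H0 + \<delta> \<longrightarrow> x * s - \<eta> * max 0 (s - trf H0) \<le> \<phi> s"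
      using loc[rule_format, OF decomp_trf_nonneg[OF d th]] by blast
    have fH': "form_le H0 ((c + x) * trf H0)"
      using fH x(4) by (simp add: f_def algebra_simps)
    then have "R \<in> cone_f (\<lambda>s. (c + x) * s) \<theta>"
      using d unfolding cone_f_iff by blast
    then have g: "gains (c + x) \<eta> \<theta> R"
      using x(2) R(2) unfolding P_def by blast
    show "\<exists>\<Lambda>>0. \<exists>\<epsilon>>0. \<forall>V. alg_curv V \<longrightarrow> (\<forall>i j k l. \<bar>V i j k l - Qop R i j k l\<bar> \<le> \<epsilon>) \<longrightarrow>
        (\<forall>x. 0 \<le> x \<and> x \<le> \<Lambda> \<longrightarrow> (\<lambda>i j k l. R i j k l + x * V i j k l) \<in> cone_f f \<theta>)"
    proof (rule cone_f_step[OF th d fH' g less_imp_le[OF x(1)] x(3)])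
      fix s assume "0 \<le> s" "s \<le> trf H0 + \<delta>"
      then have "x * s - \<eta> * max 0 (s - trf H0) \<le> \<phi> s" using x(5) by blast
      then show "(c + x) * s - \<eta> * max 0 (s - trf H0) \<le> f s"
        by (simp add: f_def algebra_simps)
    qed
  qed
  ultimately show ?thesis by blast
qed

end
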